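(* Let $(X,d)$ be a totally bounded and doubling metric space such that $\dim_{qH} X<1$. Then $$C\dim_A^\theta X = 0\qquad\text{for all } 0<\theta<1.$$ In particular, $C\overline{\dim}_B X=0$.
   Context: A metric space is doubling if there is a constant $C>0$ so that every ball $B(x,r)$ can be covered by at most $C$ balls of radius $r/2$. It is uniformly perfect if there is $0<c<1$ such that $B(x,r)\setminus B(x,cr)\ne\emptyset$ for every closed ball $B(x,r)$ with $r$ smaller than the diameter of the space. Upper $\theta$-intermediate dimension: for a totally bounded metric space $X$ and $0<\theta<1$, fix an isometric embedding of $X$ into a uniformly perfect metric space $Z$ having at least two points (for instance $Z=\ell^\infty$; the resulting value does not depend on the choice). Then $\overline{\dim}_\theta X$ is the infimum of those $s>0$ such that for each $\epsilon>0$ there exists $\delta_0>0$ so that for each $0<\delta\le\delta_0$ there is a countable covering $(A_i)$ of $X$ by subsets of $Z$ with $\delta^{1/\theta}\le\operatorname{diam}(A_i)\le\delta$ for all $i$ and $\sum_i(\operatorname{diam}A_i)^s<\epsilon$. The (upper) quasi-Hausdorff dimension is $\dim_{qH}X:=\lim_{\theta\searrow0}\overline{\dim}_\theta X$ (the limit exists since $\theta\mapsto\overline{\dim}_\theta X$ is nondecreasing). For a totally bounded set $A$ and $r>0$, $N(A,r)$ is the minimal number of sets of diameter at most $r$ needed to cover $A$. The (upper) box-counting dimension is $\overline{\dim}_B X:=\limsup_{r\to0}\frac{\log N(X,r)}{-\log r}$. (Upper) Assouad spectrum: for $0<\theta<1$, $\dim_A^\theta X$ is the infimum of those $s>0$ for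 which there is a constant $C>0$ such that $N(B(x,R),r)\le C(R/r)^s$ for every $x\in X$ and all $0<r\le R^{1/\theta}\le R\le1$. Metric spaces $(X,d)$ and $(Y,d')$ are quasisymmetrically equivalent if there exist a homeomorphism $f:X\to Y$ and an increasing homeomorphism $\eta:[0,\infty)\to[0,\infty)$ with $\frac{d'(f(x),f(a))}{d'(f(x),f(b))}\le\eta\left(\frac{d(x,a)}{d(x,b)}\right)$ for all $x,a,b\in X$, $x\ne b$. For $\dim$ equal to $\dim_A^\theta$ or $\overline{\dim}_B$, the conformal dimension $C\dim X$ (written $C\dim_A^\theta X$, $C\overline{\dim}_B X$) is the infimum of $\dim Y$ over all metric spaces $Y$ quasisymmetrically equivalent to $X$. *)

theory Defs
  imports "HOL-Analysis.Analysis"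
begin

text \<open>
  Metric spaces are given by a carrier and a distance function, as in the locale
  \<^locale>\<open>Metric_space\<close>.  All balls are closed balls.
\<close>

definition mdiam :: "('a \<Rightarrow> 'a \<Rightarrow> real) \<Rightarrow> 'a set \<Rightarrow> ennreal" where
  "mdiam d S = (SUP x\<in>S. SUP y\<in>S. ennreal (d x y))"

definition doubling :: "'a set \<Rightarrow> ('a \<Rightarrow> 'a \<Rightarrow> real) \<Rightarrow> bool" where
  "doubling M d \<longleftrightarrow>
    (\<exists>C>0::real. \<forall>x\<in>M. \<forall>r>0. \<exists>K. finite K \<and> K \<subseteq> M \<and> real (card K) \<le> C \<and>
       Metric_space.mcball M d x r \<subseteq> (\<Union>y\<in>K. Metric_space.mcball M d y (r / 2)))"

definition uniformly_perfect :: "'a set \<Rightarrow> ('a \<Rightarrow> 'a \<Rightarrow> real) \<Rightarrow> bool" where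
  "uniformly_perfect M d \<longleftrightarrow>
    (\<exists>c::real. 0 < c \<and> c < 1 \<and>
       (\<forall>x\<in>M. \<forall>r>0. ennreal r < mdiam d M \<longrightarrow>
          Metric_space.mcball M d x r - Metric_space.mcball M d x (c * r) \<noteq> {}))"

text \<open>
  The upper \<open>\<theta>\<close>-intermediate dimension of a subset \<open>A\<close> of the ambient space \<open>(Z, d)\<close>.
  For an abstract space \<open>X\<close>, this is applied to the image of \<open>X\<close> under an isometric
  embedding into a uniformly perfect space \<open>Z\<close> with at least two points.  The
  diameters in the sum lie in \<open>[\<delta> powr (1 / \<theta>), \<delta>]\<close>, so \<^const>\<open>enn2real\<close> loses nothing.
\<close>

definition upper_intermediate_dim ::
    "'b set \<Rightarrow> ('b \<Rightarrow> 'b \<Rightarrow> real) \<Rightarrow> 'b set \<Rightarrow> real \<Rightarrow> ereal" where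
  "upper_intermediate_dim Z d A \<theta> =
    Inf {ereal s | s. s > 0 \<and>
      (\<forall>\<epsilon>>0. \<exists>\<delta>\<^sub>0>0. \<forall>\<delta>. 0 < \<delta> \<and> \<delta> \<le> \<delta>\<^sub>0 \<longrightarrow>
        (\<exists>(I :: nat set) (U :: nat \<Rightarrow> 'b set).
          A \<subseteq> (\<Union>i\<in>I. U i) \<and>
          (\<forall>i\<in>I. U i \<subseteq> Z \<and>
             ennreal (\<delta> powr (1 / \<theta>)) \<le> mdiam d (U i) \<and> mdiam d (U i) \<le> ennreal \<delta>) \<and>
          (\<Sum>\<^sub>\<infinity>i\<in>I. ennreal (enn2real (mdiam d (U i)) powr s)) < ennreal \<epsilon>))}"

definition quasi_Hausdorff_dim ::
    "'b set \<Rightarrow> ('b \<Rightarrow> 'b \<Rightarrow> real) \<Rightarrow> 'b set \<Rightarrow> ereal" where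
  "quasi_Hausdorff_dim Z d A = Lim (at_right 0) (\<lambda>\<theta>. upper_intermediate_dim Z d A \<theta>)"

text \<open>The value is \<open>\<infinity>\<close> if there is no finite cover by sets of diameter at most \<open>r\<close>.\<close>

definition covering_number ::
    "'a set \<Rightarrow> ('a \<Rightarrow> 'a \<Rightarrow> real) \<Rightarrow> 'a set \<Rightarrow> real \<Rightarrow> enat" where
  "covering_number M d A r =
    Inf {enat (card F) | F. finite F \<and> (\<forall>E\<in>F. E \<subseteq> M \<and> mdiam d E \<le> ennreal r) \<and> A \<subseteq> \<Union>F}"

definition upper_box_dim :: "'a set \<Rightarrow> ('a \<Rightarrow> 'a \<Rightarrow> real) \<Rightarrow> ereal" where
  "upper_box_dim M d =
    Limsup (at_right 0)
      (\<lambda>r. case covering_number M d M r of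
             enat n \<Rightarrow> ereal (ln (real n) / - ln r)
           | \<infinity> \<Rightarrow> \<infinity>)"

definition assouad_spectrum :: "real \<Rightarrow> 'a set \<Rightarrow> ('a \<Rightarrow> 'a \<Rightarrow> real) \<Rightarrow> ereal" where
  "assouad_spectrum \<theta> M d =
    Inf {ereal s | s. s > 0 \<and>
      (\<exists>C>0. \<forall>x\<in>M. \<forall>r R. 0 < r \<and> r \<le> R powr (1 / \<theta>) \<and> R powr (1 / \<theta>) \<le> R \<and> R \<le> 1 \<longrightarrow>
         ereal_of_enat (covering_number M d (Metric_space.mcball M d x R) r)
           \<le> ereal (C * (R / r) powr s))}"

definition quasisymmetrically_equivalent ::
    "'a set \<Rightarrow> ('a \<Rightarrow> 'a \<Rightarrow> real) \<Rightarrow> 'b set \<Rightarrow> ('b \<Rightarrow> 'b \<Rightarrow> real) \<Rightarrow> bool" where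
  "quasisymmetrically_equivalent M d N e \<longleftrightarrow>
    (\<exists>f \<eta> \<eta>'.
      homeomorphic_map (Metric_space.mtopology M d) (Metric_space.mtopology N e) f \<and>
      homeomorphism {0..} {0..} \<eta> \<eta>' \<and> strict_mono_on {0::real..} \<eta> \<and>
      (\<forall>x\<in>M. \<forall>a\<in>M. \<forall>b\<in>M. x \<noteq> b \<longrightarrow>
         e (f x) (f a) / e (f x) (f b) \<le> \<eta> (d x a / d x b)))"

text \<open>
  The infimum over all metric spaces \<open>Y\<close> quasisymmetrically equivalent to \<open>M\<close>.  It suffices
  to let \<open>Y\<close> range over the spaces with points in the type of \<open>M\<close>: an equivalence is a
  bijection, so each such \<open>Y\<close> is isometric to \<open>M\<close> with the metric pulled back, and \<open>D\<close>
  is meant to be an isometry invariant.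
\<close>

definition conformal_dim ::
    "('a set \<Rightarrow> ('a \<Rightarrow> 'a \<Rightarrow> real) \<Rightarrow> ereal) \<Rightarrow> 'a set \<Rightarrow> ('a \<Rightarrow> 'a \<Rightarrow> real) \<Rightarrow> ereal" where
  "conformal_dim D M d =
    Inf {D Y e | Y e. Metric_space Y e \<and> quasisymmetrically_equivalent M d Y e}"

end

theory Submission
  imports Defs
begin

text \<open>
  Since \<open>dim\<^sub>q\<^sub>H X < 1\<close>, for some \<open>s < 1\<close> and \<open>m\<close> every small \<open>\<rho>\<close> admits a cover of \<open>X\<close> by balls
  with \<open>\<Sum> r\<^sup>s \<le> \<rho>\<close> and all radii at least \<open>\<rho> ^ m\<close>.  Enlarging such a cover by the factor \<open>C\<close>
  again and again, each time merging balls until the cover satisfies a Carleson packing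
  condition, and doing so for a doubly exponential sequence of \<open>\<rho>\<close>, gives nested layers of
  covers \<open>L 0, L 1, \<dots>\<close> with only exponentially many balls in \<open>L j\<close>.

  Let \<open>depth x y\<close> be the number of layers in which \<open>x\<close> and \<open>y\<close> share a ball, and put
  \<open>q x y = d x y / C ^ (K * depth x y)\<close>.  Packing with an exponent \<open>s < 1\<close> means that the balls
  of the layer just below the one separating \<open>x\<close> from \<open>y\<close> have small total radius near \<open>x\<close>, so
  collapsing them changes \<open>d x y\<close> by at most a factor 2.  Hence \<open>q\<close> is comparable to the largest
  metric below it; this metric is quasisymmetric to \<open>d\<close>, and a ball of layer \<open>j\<close> has diameter
  of order at most \<open>C ^ (- K * j)\<close> in it.  As \<open>K\<close> grows, the box-counting exponent tends to 0.  For
  \<open>r \<le> R powr (1 / \<theta>)\<close> the ratio \<open>R / r\<close> is at least \<open>r powr (\<theta> - 1)\<close>, so the global box-counting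
  bound also controls the Assouad spectrum.
\<close>

subsection \<open>Families of balls\<close>

text \<open>A ball is kept as a pair of centre and radius, since its point set need not determine
  either of them.\<close>

definition mass :: "real \<Rightarrow> ('a \<times> real) set \<Rightarrow> real" where
  "mass s B = (\<Sum>(p, r)\<in>B. r powr s)"

context Metric_space
begin

definition ball_family :: "('a \<times> real) set \<Rightarrow> bool" where
  "ball_family B \<longleftrightarrow> finite B \<and> (\<forall>(p, r)\<in>B. p \<in> M \<and> 0 < r)"

text \<open>Carleson packing with exponent \<open>s\<close>: every ball that meets the closed ball
  of radius \<open>D\<close> around \<open>x\<close> satisfies \<open>d x p \<le> D + r\<close>. The
  constant 3 leaves room for replacing a group of balls by one of radius \<open>3 * D\<close>,
  because \<open>3 powr s \<le> 3\<close> for \<open>s < 1\<close>.\<close>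

definition packed :: "real \<Rightarrow> ('a \<times> real) set \<Rightarrow> bool" where
  "packed s B \<longleftrightarrow>
    (\<forall>x\<in>M. \<forall>D>0. mass s {(p, r)\<in>B. r \<le> D \<and> d x p \<le> D + r} \<le> 3 * D powr s)"

text \<open>Containment of the \<open>c\<close>-fold dilated balls, in terms of centres and radii.
  It implies inclusion of the point sets and can be iterated.\<close>

definition absorbed :: "real \<Rightarrow> ('a \<times> real) set \<Rightarrow> ('a \<times> real) set \<Rightarrow> bool" where
  "absorbed c A B \<longleftrightarrow> (\<forall>(p, r)\<in>A. \<exists>(p', r')\<in>B. d p p' + c * r \<le> r')"

lemma mass_mono:
  assumes "finite B" "A \<subseteq> B"
  shows "mass s A \<le> mass s B"
  unfolding mass_def by (rule sum_mono2) (use assms in auto)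

lemma mass_pos_le:
  assumes "finite B" "(p, r) \<in> B"
  shows "r powr s \<le> mass s B"
  using mass_mono[of B "{(p, r)}" s] assms by (simp add: mass_def)

lemma mass_image_le:
  assumes "finite I"
  shows "mass s ((\<lambda>i. (f i, g i)) ` I) \<le> (\<Sum>i\<in>I. g i powr s)"
  unfolding mass_def
  using sum_image_le[of I "\<lambda>(p, r). r powr s" "\<lambda>i. (f i, g i)"] assms
  by (auto simp: o_def)

text \<open>Replacing an overcrowded group of balls by the single ball \<open>(x, 3 * D)\<close> lowers the
  mass, so a family with the fewest balls is packed.\<close>
lemma coarsening_exists:
  assumes B: "ball_family B" and C: "0 < C" and s: "0 < s" "s < 1"
  obtains B' where "ball_family B'" "absorbed C B B'" "mass s B' \<le> C powr s * mass s B"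
    "card B' \<le> card B" "packed s B'"
proof -
  define P where "P B' \<longleftrightarrow> ball_family B' \<and> absorbed C B B' \<and>
    mass s B' \<le> C powr s * mass s B" for B'
  define B0 where "B0 = (\<lambda>(p, r). (p, C * r)) ` B"
  have finB: "finite B" and valB: "\<And>p r. (p, r) \<in> B \<Longrightarrow> p \<in> M \<and> 0 < r"
    using B by (auto simp: ball_family_def)
  have "mass s B0 \<le> (\<Sum>(p, r)\<in>B. (C * r) powr s)"
    using mass_image_le[OF finB, of s fst "\<lambda>b. C * snd b"]
    by (simp add: B0_def case_prod_unfold)
  also have "\<dots> = C powr s * mass s B"
    unfolding mass_def sum_distrib_left
    by (rule sum.cong) (use valB C in \<open>auto simp: powr_mult less_imp_le\<close>)
  finally have mass_B0: "mass s B0 \<le> C powr s * mass s B" .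
  have "ball_family B0"
    unfolding ball_family_def B0_def using finB valB C by (auto split: prod.splits)
  moreover have "absorbed C B B0"
    unfolding absorbed_def
  proof (clarify)
    fix p r assume pr: "(p, r) \<in> B"
    have "(p, C * r) \<in> B0" unfolding B0_def using pr by force
    moreover have "d p p = 0" using valB[OF pr] by simp
    ultimately show "\<exists>(p', r')\<in>B0. d p p' + C * r \<le> r'" by (intro bexI[of _ "(p, C * r)"]) auto
  qed
  ultimately have "P B0" using mass_B0 by (simp add: P_def)
  then obtain B' where B': "P B'" and min: "\<And>B''. P B'' \<Longrightarrow> card B' \<le> card B''"
    using ex_has_least_nat[of P B0 card] by blast
  have finB': "finite B'" and valB': "\<And>p r. (p, r) \<in> B' \<Longrightarrow> p \<in> M \<and> 0 < r"
    using B' by (auto simp: P_def ball_family_def)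
  have "card B' \<le> card B"
    using min[OF \<open>P B0\<close>] card_image_le[OF finB, of "\<lambda>(p, r). (p, C * r)"] by (simp add: B0_def)
  moreover have "packed s B'"
    unfolding packed_def
  proof (intro ballI allI impI, rule ccontr)
    fix x D assume x: "x \<in> M" and D: "(D::real) > 0"
    define S where "S = {(p, r)\<in>B'. r \<le> D \<and> d x p \<le> D + r}"
    assume "\<not> mass s {(p, r)\<in>B'. r \<le> D \<and> d x p \<le> D + r} \<le> 3 * D powr s"
    then have big: "mass s S > 3 * D powr s" by (simp add: S_def)
    have SB: "S \<subseteq> B'" and finS: "finite S" using finB' by (auto simp: S_def intro: finite_subset)
    \<comment> \<open>Every ball of \<open>S\<close> weighs at most \<open>D powr s\<close>, so the
      excess mass comes from several balls and their merger lowers the cardinality.\<close>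
    have "mass s S \<le> (\<Sum>b\<in>S. D powr s)"
      unfolding mass_def
    proof (rule sum_mono, clarify)
      fix p r assume "(p, r) \<in> S"
      then show "r powr s \<le> D powr s"
        using valB'[of p r] s by (intro powr_mono2) (auto simp: S_def)
    qed
    then have "3 * D powr s < real (card S) * D powr s" using big by simp
    then have cardS: "card S > 3" using D by simp
    define B'' where "B'' = insert (x, 3 * D) (B' - S)"
    have "card B'' \<le> Suc (card (B' - S))"
      unfolding B''_def by (simp add: card_insert_le_m1 card_insert_if finB')
    also have "\<dots> < card B'"
      using card_Diff_subset[OF finS SB] cardS card_mono[OF finB' SB] by simp
    finally have lt: "card B'' < card B'" .
    have "mass s B'' \<le> (3 * D) powr s + mass s (B' - S)"
      unfolding B''_def mass_def using finB' by (simp add: sum.insert_if)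
    also have "mass s (B' - S) = mass s B' - mass s S"
      unfolding mass_def by (rule sum_diff[OF finB' SB])
    also have "(3 * D) powr s \<le> 3 * D powr s"
      using D s powr_mono[of s 1 3] by (simp add: powr_mult)
    finally have cont: "mass s B'' \<le> C powr s * mass s B"
      using big B' by (simp add: P_def)
    have "absorbed C B B''"
      unfolding absorbed_def
    proof (clarify)
      fix p r assume "(p, r) \<in> B"
      moreover have "absorbed C B B'" using B' by (simp add: P_def)
      ultimately obtain p' r' where p': "(p', r') \<in> B'" "d p p' + C * r \<le> r'"
        unfolding absorbed_def by blast
      show "\<exists>(p', r')\<in>B''. d p p' + C * r \<le> r'"
      proof (cases "(p', r') \<in> S")
        case True
        \<comment> \<open>For a removed ball, \<open>d p p' + C * r \<le> r' \<le> D\<close> and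
          \<open>d x p' \<le> D + r' \<le> 2 * D\<close>. These add up to the radius
          \<open>3 * D\<close>.\<close>
        have "d p x \<le> d p p' + d p' x"
          using triangle valB \<open>(p, r) \<in> B\<close> valB' p' x by blast
        then have "d p x + C * r \<le> 3 * D"
          using True p' by (simp add: S_def commute)
        then show ?thesis by (auto simp: B''_def)
      next
        case False
        then show ?thesis using p' by (auto simp: B''_def)
      qed
    qed
    moreover have "ball_family B''"
      using finB' valB' x D by (auto simp: ball_family_def B''_def)
    ultimately have "P B''" using cont by (simp add: P_def)
    then show False using min lt by fastforce
  qed
  ultimately show ?thesis using that B' by (auto simp: P_def)
qed

end

subsection \<open>The metric of a layered space\<close>

text \<open>Take for \<open>g t\<close> the Lebesgue measure of the part of \<open>{0..t}\<close>
  that lies in \<open>{0..D}\<close> and outside all the intervals. It grows at most at unit speed,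
  stops on each interval and beyond \<open>D\<close>, and loses at most the total length of the
  intervals.\<close>

lemma collapse_intervals:
  fixes D :: real and I :: "'i set" and c r :: "'i \<Rightarrow> real"
  assumes I: "finite I" and D: "0 \<le> D" and r: "\<And>i. i \<in> I \<Longrightarrow> 0 \<le> r i"
  obtains g :: "real \<Rightarrow> real" where
    "\<And>t t'. 0 \<le> t \<Longrightarrow> 0 \<le> t' \<Longrightarrow> \<bar>g t - g t'\<bar> \<le> \<bar>t - t'\<bar>"
    "\<And>i t t'. i \<in> I \<Longrightarrow> 0 \<le> t \<Longrightarrow> 0 \<le> t' \<Longrightarrow> \<bar>t - c i\<bar> \<le> r i \<Longrightarrow> \<bar>t' - c i\<bar> \<le> r i \<Longrightarrow> g t = g t'"
    "\<And>t t'. D \<le> t \<Longrightarrow> D \<le> t' \<Longrightarrow> g t = g t'"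
    "g 0 = 0" "D - 2 * (\<Sum>i\<in>I. r i) \<le> g D"
proof -
  define N where "N = (\<Union>i\<in>I. {c i - r i .. c i + r i})"
  define T where "T = {0..D} - N"
  define g where "g t = measure lborel ({0..t} \<inter> T)" for t
  have N: "N \<in> sets borel" unfolding N_def using I by (intro sets.finite_UN) auto
  then have T: "T \<in> sets borel" by (simp add: T_def)
  have fm: "A \<inter> T \<in> fmeasurable lborel" if "A \<in> sets borel" for A
  proof (rule fmeasurableI2[of "{0..D}"])
    show "{0..D} \<in> fmeasurable lborel" using D by (simp add: fmeasurable_def)
  qed (use that T in \<open>auto simp: T_def\<close>)
  have step: "g t' - g t = measure lborel ({t<..t'} \<inter> T)" if "0 \<le> t" "t \<le> t'" for t t'
  proof -
    have "{0..t'} \<inter> T = ({0..t} \<inter> T) \<union> ({t<..t'} \<inter> T)" using that by auto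
    moreover have "({t<..t'} \<inter> T) - ({0..t} \<inter> T) = {t<..t'} \<inter> T" by auto
    ultimately show ?thesis
      using measure_Un2[OF fm fm, of "{0..t}" "{t<..t'}"] by (simp add: g_def)
  qed
  have lip: "\<bar>g t - g t'\<bar> \<le> \<bar>t - t'\<bar>" if "0 \<le> t" "t \<le> t'" for t t'
  proof -
    have "measure lborel ({t<..t'} \<inter> T) \<le> measure lborel {t<..t'}"
      by (rule measure_mono_fmeasurable) (use T that in \<open>auto simp: fmeasurable_def emeasure_lborel_Icc_eq\<close>)
    also have "\<dots> = t' - t" using that by simp
    finally show ?thesis
      using step[OF that] that measure_nonneg[of lborel "{t<..t'} \<inter> T"] by linarith
  qed
  have const: "g t = g t'" if "0 \<le> t" "t \<le> t'" "{t<..t'} \<inter> T = {}" for t t'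
    using step[OF that(1,2)] that(3) by simp
  have "measure lborel N \<le> (\<Sum>i\<in>I. measure lborel {c i - r i .. c i + r i})"
    unfolding N_def by (rule measure_UNION_le) (use I in auto)
  also have "\<dots> = 2 * (\<Sum>i\<in>I. r i)"
    unfolding sum_distrib_left by (rule sum.cong) (use r in auto)
  finally have N_le: "measure lborel N \<le> 2 * (\<Sum>i\<in>I. r i)" .
  have "D = measure lborel {0..D}" using D by simp
  also have "\<dots> = measure lborel (({0..D} \<inter> N) \<union> T)"
    by (rule arg_cong[where f = "measure lborel"]) (auto simp: T_def)
  also have "\<dots> \<le> measure lborel ({0..D} \<inter> N) + measure lborel T"
    by (rule measure_Un_le) (use N T in auto)
  also have "measure lborel ({0..D} \<inter> N) \<le> measure lborel N"
  proof (rule measure_mono_fmeasurable)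
    show "N \<in> fmeasurable lborel"
      unfolding N_def by (intro fmeasurable.finite_UN I) (auto simp: fmeasurable_def emeasure_lborel_Icc_eq)
  qed (use N in auto)
  also have "measure lborel T = g D"
    unfolding g_def by (rule arg_cong[where f = "measure lborel"]) (auto simp: T_def)
  finally have gD: "D - 2 * (\<Sum>i\<in>I. r i) \<le> g D" using N_le by simp
  have g0: "g 0 = 0"
  proof -
    have "measure lborel ({0..0} \<inter> T) \<le> measure lborel {0..0::real}"
      by (rule measure_mono_fmeasurable) (use T in \<open>auto simp: fmeasurable_def emeasure_lborel_Icc_eq\<close>)
    then show ?thesis by (simp add: g_def antisym)
  qed
  show ?thesis
  proof (rule that[of g])
    show "\<bar>g t - g t'\<bar> \<le> \<bar>t - t'\<bar>" if "0 \<le> t" "0 \<le> t'" for t t'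
      using lip[of t t'] lip[of t' t] that by linarith
    show "g t = g t'" if "i \<in> I" "0 \<le> t" "0 \<le> t'" "\<bar>t - c i\<bar> \<le> r i" "\<bar>t' - c i\<bar> \<le> r i" for i t t'
    proof -
      have "{t<..t'} \<inter> T = {}" "{t'<..t} \<inter> T = {}"
        using that by (force simp: T_def N_def abs_le_iff)+
      then show ?thesis using const[of t t'] const[of t' t] that by linarith
    qed
    show "g t = g t'" if "D \<le> t" "D \<le> t'" for t t'
    proof -
      have "{t<..t'} \<inter> T = {}" "{t'<..t} \<inter> T = {}"
        using that by (auto simp: T_def)
      then show ?thesis using const[of t t'] const[of t' t] that D by linarith
    qed
  qed (use g0 gD in auto)
qed

text \<open>The control function of the quasisymmetry. The maximum is \<open>t\<close> up to 1 and
  \<open>t ^ Suc K\<close> from there on; the minimum of the two branch inverses selects the right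
  one on either side of 1.\<close>

lemma homeomorphism_max_power:
  fixes A :: real
  assumes "0 < A"
  shows "homeomorphism {0..} {0..} (\<lambda>t. A * max t (t ^ Suc K))
      (\<lambda>v. min (v / A) (root (Suc K) (v / A)))"
    and "strict_mono_on {0..} (\<lambda>t. A * max t (t ^ Suc K))"
proof -
  have inv1: "min (max t (t ^ Suc K)) (root (Suc K) (max t (t ^ Suc K))) = t" if "0 \<le> t" for t :: real
  proof (cases "t \<le> 1")
    case True
    have "t ^ Suc K \<le> t ^ 1" using that True by (intro power_decreasing) auto
    then have "max t (t ^ Suc K) = t" by (simp add: max_def)
    moreover have "t \<le> root (Suc K) t"
      using \<open>t ^ Suc K \<le> t ^ 1\<close> that real_root_le_mono[of "Suc K" "t ^ Suc K" t]
      by (simp add: real_root_pos2 del: power_Suc)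
    ultimately show ?thesis by simp
  next
    case False
    have "t ^ 1 \<le> t ^ Suc K" using False by (intro power_increasing) auto
    then show ?thesis
      using that by (simp add: max_def real_root_pos2 del: power_Suc)
  qed
  have inv2: "max (min v (root (Suc K) v)) (min v (root (Suc K) v) ^ Suc K) = v" if "0 \<le> v" for v :: real
  proof (cases "v \<le> 1")
    case True
    have *: "v ^ Suc K \<le> v ^ 1" using that True by (intro power_decreasing) auto
    then have "v \<le> root (Suc K) v"
      using that real_root_le_mono[of "Suc K" "v ^ Suc K" v]
      by (simp add: real_root_pos2 del: power_Suc)
    then have "min v (root (Suc K) v) = v" by simp
    then show ?thesis using * by (simp add: max_def)
  next
    case False
    have "v ^ 1 \<le> v ^ Suc K" using False by (intro power_increasing) auto
    then have le: "root (Suc K) v \<le> v"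
      using that real_root_le_mono[of "Suc K" v "v ^ Suc K"]
      by (simp add: real_root_pos2 del: power_Suc)
    have "root (Suc K) v ^ Suc K = v" using that by (simp add: real_root_pow_pos2 del: power_Suc)
    then show ?thesis using le by (simp only: min_absorb2 max_absorb2)
  qed
  show "homeomorphism {0..} {0..} (\<lambda>t. A * max t (t ^ Suc K))
      (\<lambda>v. min (v / A) (root (Suc K) (v / A)))"
  proof (rule homeomorphismI)
    show "continuous_on {0..} (\<lambda>t. A * max t (t ^ Suc K))"
      by (intro continuous_intros)
    show "continuous_on {0..} (\<lambda>v. min (v / A) (root (Suc K) (v / A)))"
      using assms by (intro continuous_intros) auto
    show "min (A * max t (t ^ Suc K) / A) (root (Suc K) (A * max t (t ^ Suc K) / A)) = t"
      if "t \<in> {0..}" for t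
      using inv1[of t] that assms by simp
    show "A * max (min (v / A) (root (Suc K) (v / A))) (min (v / A) (root (Suc K) (v / A)) ^ Suc K) = v"
      if "v \<in> {0..}" for v
      using inv2[of "v / A"] that assms by simp
  qed (use assms in \<open>auto simp: le_max_iff_disj min_def\<close>)
  show "strict_mono_on {0..} (\<lambda>t. A * max t (t ^ Suc K))"
  proof (rule strict_mono_onI)
    fix t u :: real assume "t \<in> {0..}" "u \<in> {0..}" "t < u"
    then have "t ^ Suc K < u ^ Suc K" by (intro power_strict_mono) auto
    then show "A * max t (t ^ Suc K) < A * max u (u ^ Suc K)"
      using \<open>t < u\<close> assms by (auto simp: max_def)
  qed
qed

text \<open>Layers become finer as the index grows. By the second bound on \<open>C\<close>, packed
  balls near a point at scale \<open>D\<close> with radii below \<open>2 / (C - 1) * D\<close> have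
  total radius at most \<open>D / 4\<close>. Large \<open>C\<close> satisfy it since
  \<open>1 - s\<close> is positive.\<close>

locale layered_space = Metric_space +
  fixes L :: "nat \<Rightarrow> ('a \<times> real) set" and s C :: real
  assumes family: "ball_family (L j)"
    and nested: "absorbed C (L (Suc j)) (L j)"
    and packing: "packed s (L j)"
    and covers: "x \<in> M \<Longrightarrow> \<exists>(p, r)\<in>L j. d p x \<le> r"
    and s: "0 < s" "s < 1"
    and C: "3 \<le> C" "12 * (2 / (C - 1)) powr (1 - s) \<le> 1"
begin

definition near :: "nat \<Rightarrow> 'a \<Rightarrow> 'a \<Rightarrow> bool" where
  "near j x y \<longleftrightarrow> (\<exists>(p, r)\<in>L j. d p x \<le> r \<and> d p y \<le> r)"

text \<open>The cardinality is junk for \<open>x = y\<close>, where every layer has a common ball.\<close>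
definition depth :: "'a \<Rightarrow> 'a \<Rightarrow> nat" where
  "depth x y = card {j. near j x y}"

definition shrunk :: "nat \<Rightarrow> 'a \<Rightarrow> 'a \<Rightarrow> real" where
  "shrunk K x y = d x y / C ^ (K * depth x y)"

definition shrunk_lipschitz :: "nat \<Rightarrow> ('a \<Rightarrow> real) set" where
  "shrunk_lipschitz K = {u. \<forall>a\<in>M. \<forall>b\<in>M. \<bar>u a - u b\<bar> \<le> shrunk K a b}"

text \<open>The largest pseudometric on \<open>M\<close> below \<open>shrunk K\<close>, written by
  duality with Lipschitz functions instead of chains: a lower bound then needs only one function.
  The value 0 off \<open>M\<close> gives the nonnegativity and symmetry that
  \<open>Metric_space\<close> asks of all points of the type.\<close>

definition shrunk_metric :: "nat \<Rightarrow> 'a \<Rightarrow> 'a \<Rightarrow> real" where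
  "shrunk_metric K x y =
    (if x \<in> M \<and> y \<in> M then SUP u\<in>shrunk_lipschitz K. \<bar>u x - u y\<bar> else 0)"

section \<open>Balls of successive layers and the depth of a pair of points\<close>

lemma finite_layer: "finite (L j)" and centre: "(p, r) \<in> L j \<Longrightarrow> p \<in> M"
  and radius_pos: "(p, r) \<in> L j \<Longrightarrow> 0 < r"
  using family[of j] by (auto simp: ball_family_def)

lemma C_power_ge_1: "1 \<le> C ^ n" using C by simp

lemma absorbed_iterate:
  "(p, r) \<in> L (j + i) \<Longrightarrow> \<exists>(p', r')\<in>L j. d p p' + C ^ i * r \<le> r'"
proof (induction i arbitrary: p r)
  case 0
  have "d p p = 0" using centre 0 by simp
  then show ?case using 0 by (intro bexI[of _ "(p, r)"]) auto
next
  case (Suc i)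
  obtain p1 r1 where 1: "(p1, r1) \<in> L (j + i)" "d p p1 + C * r \<le> r1"
    using nested[of "j + i"] Suc.prems by (fastforce simp: absorbed_def)
  obtain p' r' where 2: "(p', r') \<in> L j" "d p1 p' + C ^ i * r1 \<le> r'"
    using Suc.IH[OF 1(1)] by auto
  have "d p p' \<le> d p p1 + d p1 p'"
    using triangle centre 1 2 Suc.prems by blast
  moreover have "C ^ i * (d p p1 + C * r) \<le> C ^ i * r1"
    using 1 C_power_ge_1[of i] by (intro mult_left_mono) auto
  moreover have "1 * d p p1 \<le> C ^ i * d p p1"
    using C_power_ge_1[of i] by (intro mult_right_mono) auto
  ultimately have "d p p' + C ^ Suc i * r \<le> r'"
    using 2(2) by (simp add: algebra_simps)
  then show ?case using 2 by auto
qed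

text \<open>A common ball \<open>(p, r)\<close> gives \<open>d x y \<le> 2 * r\<close>, so
  \<open>z\<close> has distance at most \<open>(1 + 2 * t) * r\<close> from \<open>p\<close>. The
  ball of layer \<open>j\<close> that absorbs the \<open>C ^ i\<close>-fold dilation of
  \<open>(p, r)\<close> therefore contains \<open>z\<close>.\<close>

lemma near_dilate:
  assumes xy: "near (j + i) x y" and M: "x \<in> M" "y \<in> M" "z \<in> M"
    and z: "d x z \<le> t * d x y" "0 \<le> t" "1 + 2 * t \<le> C ^ i"
  shows "near j x z"
proof -
  obtain p r where p: "(p, r) \<in> L (j + i)" "d p x \<le> r" "d p y \<le> r"
    using xy by (auto simp: near_def)
  obtain p' r' where p': "(p', r') \<in> L j" "d p p' + C ^ i * r \<le> r'"
    using absorbed_iterate[OF p(1)] by auto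
  have pM: "p \<in> M" "p' \<in> M" "0 < r" using centre p p' radius_pos by auto
  have "d x y \<le> 2 * r" using triangle[of x p y] M pM p commute[of x p] by linarith
  then have "t * d x y \<le> t * (2 * r)" using z by (intro mult_left_mono) auto
  moreover have "(1 + 2 * t) * r \<le> C ^ i * r" using z pM by (intro mult_right_mono) auto
  ultimately have *: "d p p' + r + t * d x y \<le> r'" using p' by (simp add: algebra_simps)
  have px: "d p' x \<le> d p p' + r" using triangle[of p' p x] pM M p commute[of p p'] by linarith
  then have "d p' z \<le> d p p' + r + t * d x y"
    using triangle[of p' x z] pM M z by linarith
  moreover have "0 \<le> t * d x y" using z by simp
  ultimately have "d p' x \<le> r'" "d p' z \<le> r'" using * px by linarith+
  then show ?thesis using p' by (auto simp: near_def)
qed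

lemma near_antimono:
  assumes "near k x y" "j \<le> k" "x \<in> M" "y \<in> M"
  shows "near j x y"
proof (cases "j = k")
  case False
  then have "near (j + (k - j)) x y" using assms by simp
  \<comment> \<open>The case \<open>z = y\<close>, \<open>t = 1\<close> of
    \<open>near_dilate\<close>, where one layer of difference suffices because
    \<open>3 \<le> C\<close>.\<close>
  moreover have "1 + 2 * 1 \<le> C ^ (k - j)"
    using C self_le_power[of C "k - j"] False assms(2) by simp
  ultimately show ?thesis using near_dilate[of j "k - j" x y y 1] assms by simp
qed (use assms in auto)

text \<open>The sum stands in for the maximal radius of layer 0; the summand 1 keeps it positive
  when the layer is empty.\<close>

definition top_radius :: real where
  "top_radius = 1 + (\<Sum>(p, r)\<in>L 0. r)"

lemma top_radius_pos: "0 < top_radius"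
proof -
  have "0 \<le> (\<Sum>(p, r)\<in>L 0. r)"
    by (rule sum_nonneg) (auto dest: radius_pos)
  then show ?thesis by (simp add: top_radius_def)
qed

lemma radius_le:
  assumes "(p, r) \<in> L j"
  shows "C ^ j * r \<le> top_radius"
proof -
  obtain p' r' where p': "(p', r') \<in> L 0" "d p p' + C ^ j * r \<le> r'"
    using absorbed_iterate[of p r 0 j] assms by auto
  have "(\<Sum>(p, r)\<in>{(p', r')}. r) \<le> (\<Sum>(p, r)\<in>L 0. r)"
    by (rule sum_mono2) (use p'(1) finite_layer in \<open>auto dest: radius_pos\<close>)
  moreover have "C ^ j * r \<le> r'" using p' nonneg[of p p'] by linarith
  ultimately show ?thesis by (simp add: top_radius_def)
qed

lemma near_dist:
  assumes "near j x y" "x \<in> M" "y \<in> M"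
  shows "C ^ j * d x y \<le> 2 * top_radius"
proof -
  obtain p r where p: "(p, r) \<in> L j" "d p x \<le> r" "d p y \<le> r"
    using assms by (auto simp: near_def)
  have "d x y \<le> 2 * r" using triangle[of x p y] assms p commute[of x p] centre[OF p(1)] by linarith
  then have "C ^ j * d x y \<le> C ^ j * (2 * r)"
    using C_power_ge_1[of j] by (intro mult_left_mono) auto
  then show ?thesis using radius_le[OF p(1)] by simp
qed

text \<open>The layers in which two points share a ball form an initial segment by
  \<open>near_antimono\<close>. For distinct points it is finite, since by \<open>near_dist\<close>
  a common ball forces \<open>d x y\<close> to be of order \<open>C ^ j\<close> in the denominator;
  so its cardinality is the first separating layer.\<close>

lemma near_iff_depth:
  assumes M: "x \<in> M" "y \<in> M" and ne: "x \<noteq> y"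
  shows "near j x y \<longleftrightarrow> j < depth x y"
proof -
  have dpos: "0 < d x y" using assms by (simp add: less_le)
  obtain n where "2 * top_radius / d x y < C ^ n"
    using real_arch_pow[of C "2 * top_radius / d x y"] C by auto
  then have "\<not> near n x y"
    using near_dist[of n x y] M dpos by (auto simp: field_simps)
  define m where "m = (LEAST m. \<not> near m x y)"
  have "\<not> near m x y"
    unfolding m_def by (rule LeastI) (fact \<open>\<not> near n x y\<close>)
  moreover have "near i x y" if "i < m" for i
    using not_less_Least[of i "\<lambda>m. \<not> near m x y"] that by (auto simp: m_def)
  ultimately have iff: "near i x y \<longleftrightarrow> i < m" for i
    using near_antimono[OF _ _ M] by (metis not_le)
  then show ?thesis by (simp add: depth_def)
qed

section \<open>The metric generated by \<open>shrunk\<close> and its comparison with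
  \<open>shrunk\<close>\<close>

lemma shrunk_nonneg: "0 \<le> shrunk K x y"
  using C by (simp add: shrunk_def)

lemma shrunk_le: "shrunk K x y \<le> d x y"
  unfolding shrunk_def
  using divide_left_mono[of 1 "C ^ (K * depth x y)" "d x y"] C_power_ge_1[of "K * depth x y"] C
  by simp

lemma zero_lipschitz: "(\<lambda>_. 0) \<in> shrunk_lipschitz K"
  by (simp add: shrunk_lipschitz_def shrunk_nonneg)

lemma shrunk_metric_ge:
  assumes "u \<in> shrunk_lipschitz K" "x \<in> M" "y \<in> M"
  shows "\<bar>u x - u y\<bar> \<le> shrunk_metric K x y"
proof -
  have "bdd_above ((\<lambda>u. \<bar>u x - u y\<bar>) ` shrunk_lipschitz K)"
    by (rule bdd_aboveI[of _ "shrunk K x y"]) (use assms in \<open>auto simp: shrunk_lipschitz_def\<close>)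
  then show ?thesis
    unfolding shrunk_metric_def using assms by (auto intro: cSUP_upper2[of _ _ u])
qed

lemma shrunk_metric_least:
  assumes "x \<in> M" "y \<in> M" "\<And>u. u \<in> shrunk_lipschitz K \<Longrightarrow> \<bar>u x - u y\<bar> \<le> b"
  shows "shrunk_metric K x y \<le> b"
  unfolding shrunk_metric_def using assms zero_lipschitz by (auto intro!: cSUP_least)

lemma shrunk_metric_le:
  assumes "x \<in> M" "y \<in> M"
  shows "shrunk_metric K x y \<le> shrunk K x y"
  by (rule shrunk_metric_least) (use assms in \<open>auto simp: shrunk_lipschitz_def\<close>)

text \<open>With \<open>j = depth x y\<close>, no ball of layer \<open>j\<close> contains both points, so the balls of layer
  \<open>j + 1\<close> that come close to \<open>x\<close> are small compared with \<open>d x y\<close>, and by packing the sum of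
  their radii is small too.  The Lipschitz function is \<open>d x\<close> with these balls collapsed.\<close>
lemma shrunk_le_shrunk_metric:
  assumes M: "x \<in> M" "y \<in> M"
  shows "shrunk K x y \<le> 2 * C ^ K * shrunk_metric K x y"
proof (cases "x = y")
  case True
  have "shrunk_lipschitz K \<noteq> {}" using zero_lipschitz by blast
  then show ?thesis using True M by (simp add: shrunk_def shrunk_metric_def)
next
  case False
  define D where "D = d x y"
  define j where "j = depth x y"
  have D: "0 < D" using False M by (simp add: D_def less_le)
  have far: "\<not> near j x y" using near_iff_depth[OF M False] by (simp add: j_def)
  define S where "S = {(p, r)\<in>L (Suc j). r \<le> D \<and> d x p \<le> D + r}"
  \<comment> \<open>\<open>k\<close> solves \<open>2 + k = C * k\<close>: a ball of layer
    \<open>Suc j\<close> near \<open>x\<close> with radius at least \<open>k * D\<close> would be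
    absorbed by a ball of layer \<open>j\<close> containing both \<open>x\<close> and
    \<open>y\<close>.\<close>
  define k where "k = 2 / (C - 1)"
  have k: "0 < k" "k \<le> 1" using C by (auto simp: k_def)
  have small: "r < k * D" if pr: "(p, r) \<in> L (Suc j)" "d x p \<le> D + r" for p r
  proof (rule ccontr)
    assume "\<not> r < k * D"
    then have "2 * D + r \<le> C * r" using C by (simp add: k_def field_simps)
    obtain p' r' where p': "(p', r') \<in> L j" "d p p' + C * r \<le> r'"
      using nested[of j] pr(1) by (fastforce simp: absorbed_def)
    have pM: "p \<in> M" "p' \<in> M" using centre pr p' by auto
    have "d p' x \<le> d p p' + (D + r)"
      using triangle[of p' p x] pM M commute[of p p'] commute[of p x] pr by linarith
    moreover have "d p' y \<le> d p' x + D"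
      using triangle[of p' x y] pM M by (simp add: D_def)
    ultimately have "d p' x \<le> r'" "d p' y \<le> r'"
      using p' \<open>2 * D + r \<le> C * r\<close> D by linarith+
    then show False using far p' by (auto simp: near_def)
  qed
  have finS: "finite S" using finite_layer by (auto simp: S_def intro: finite_subset)
  have "(\<Sum>(p, r)\<in>S. r) \<le> (\<Sum>(p, r)\<in>S. (k * D) powr (1 - s) * r powr s)"
  proof (rule sum_mono, clarify)
    fix p r assume pr: "(p, r) \<in> S"
    then have r: "0 < r" "r \<le> k * D" using small radius_pos by (fastforce simp: S_def)+
    \<comment> \<open>Packing controls the sum of \<open>r powr s\<close>; the remaining exponent
      \<open>1 - s\<close> is spent on the smallness of the radii.\<close>
    have "r = r powr (1 - s) * r powr s" using r by (simp flip: powr_add)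
    also have "\<dots> \<le> (k * D) powr (1 - s) * r powr s"
      using r s by (intro mult_right_mono powr_mono2) auto
    finally show "r \<le> (k * D) powr (1 - s) * r powr s" .
  qed
  also have "\<dots> = (k * D) powr (1 - s) * mass s S"
    by (simp add: mass_def sum_distrib_left case_prod_unfold)
  also have "\<dots> \<le> (k * D) powr (1 - s) * (3 * D powr s)"
    using packing[of "Suc j"] M D by (intro mult_left_mono) (auto simp: packed_def S_def)
  also have "\<dots> = 3 * k powr (1 - s) * D"
    using k D by (simp add: powr_mult flip: powr_add)
  also have "4 * \<dots> \<le> D"
    using C(2) D by (simp add: k_def)
  finally have sumS: "4 * (\<Sum>(p, r)\<in>S. r) \<le> D" by simp
  have radius_nonneg: "0 \<le> snd b" if "b \<in> S" for b
    using that radius_pos[of "fst b" "snd b" "Suc j"] by (simp add: S_def case_prod_unfold)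
  obtain g where g1: "\<And>t t'. 0 \<le> t \<Longrightarrow> 0 \<le> t' \<Longrightarrow> \<bar>g t - g t'\<bar> \<le> \<bar>t - t'\<bar>"
    and g2: "\<And>b t t'. b \<in> S \<Longrightarrow> 0 \<le> t \<Longrightarrow> 0 \<le> t' \<Longrightarrow> \<bar>t - d x (fst b)\<bar> \<le> snd b \<Longrightarrow>
      \<bar>t' - d x (fst b)\<bar> \<le> snd b \<Longrightarrow> g t = g t'"
    and g3: "\<And>t t'. D \<le> t \<Longrightarrow> D \<le> t' \<Longrightarrow> g t = g t'"
    and g4: "g 0 = 0" "D - 2 * (\<Sum>b\<in>S. snd b) \<le> g D"
    by (rule collapse_intervals[OF finS less_imp_le[OF D],
          where c = "\<lambda>b. d x (fst b)" and r = snd]) (use radius_nonneg in blast, rule that)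
  \<comment> \<open>Pairs of depth above \<open>Suc j\<close> share a collapsed ball; for all others
    this denominator is large enough. As \<open>x\<close> and \<open>y\<close> have depth
    \<open>j\<close>, it costs a factor \<open>C ^ K\<close>, and the collapsing costs the factor
    2.\<close>
  define u where "u z = g (d x z) / C ^ (K * Suc j)" for z
  have collapse: "g (d x a) = g (d x b)" if ab: "near (Suc j) a b" "a \<in> M" "b \<in> M" for a b
  proof -
    obtain p r where p: "(p, r) \<in> L (Suc j)" "d p a \<le> r" "d p b \<le> r"
      using ab by (auto simp: near_def)
    have pM: "p \<in> M" using centre p by auto
    have tri: "\<bar>d x z - d x p\<bar> \<le> r" if "z \<in> M" "d p z \<le> r" for z
      using triangle[of x p z] triangle[of x z p] commute[of z p] that pM M by linarith
    show ?thesis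
    proof (cases "d x p \<le> D + r")
      case True
      have "k * D \<le> 1 * D" using k D by (intro mult_right_mono) auto
      then have "(p, r) \<in> S" using True p small[OF p(1) True] by (simp add: S_def)
      from g2[OF this] show ?thesis using tri p ab by simp
    next
      \<comment> \<open>The whole ball is farther than \<open>D\<close> from \<open>x\<close>, where
        \<open>g\<close> is constant.\<close>
      case False
      then show ?thesis using g3 tri[of a] tri[of b] p ab by fastforce
    qed
  qed
  have "u \<in> shrunk_lipschitz K"
    unfolding shrunk_lipschitz_def
  proof (clarify)
    fix a b assume ab: "a \<in> M" "b \<in> M"
    show "\<bar>u a - u b\<bar> \<le> shrunk K a b"
    proof (cases "a = b \<or> near (Suc j) a b")
      case True
      then show ?thesis using collapse ab shrunk_nonneg by (auto simp: u_def)
    next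
      case False
      then have "depth a b \<le> Suc j" using near_iff_depth[of a b "Suc j"] ab by simp
      then have pow: "C ^ (K * depth a b) \<le> C ^ (K * Suc j)"
        using C \<open>depth a b \<le> Suc j\<close> by (intro power_increasing mult_le_mono2) auto
      have "\<bar>u a - u b\<bar> = \<bar>g (d x a) - g (d x b)\<bar> / C ^ (K * Suc j)"
        using C by (simp add: u_def abs_divide flip: diff_divide_distrib)
      also have "\<dots> \<le> d a b / C ^ (K * Suc j)"
        using g1[of "d x a" "d x b"] triangle[of x a b] triangle[of x b a] commute[of a b] ab M C
        by (intro divide_right_mono) auto
      also have "\<dots> \<le> d a b / C ^ (K * depth a b)"
        using pow C by (intro divide_left_mono) auto
      finally show ?thesis by (simp add: shrunk_def)
    qed
  qed
  then have "u y - u x \<le> shrunk_metric K x y"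
    using shrunk_metric_ge[of u K x y] M by (simp add: abs_le_iff)
  moreover have "d x x = 0" using M by simp
  ultimately have "g D / C ^ (K * Suc j) \<le> shrunk_metric K x y"
    by (simp add: u_def D_def g4)
  moreover have "D / 2 / C ^ (K * Suc j) \<le> g D / C ^ (K * Suc j)"
    using g4 sumS C by (intro divide_right_mono) (auto simp: case_prod_unfold)
  ultimately have "2 * C ^ K * (D / 2 / C ^ (K * Suc j)) \<le> 2 * C ^ K * shrunk_metric K x y"
    using C by (intro mult_left_mono) auto
  moreover have "2 * C ^ K * (D / 2 / C ^ (K * Suc j)) = shrunk K x y"
    using C by (simp add: shrunk_def D_def j_def power_add)
  ultimately show ?thesis by simp
qed

lemma Metric_space_shrunk: "Metric_space M (shrunk_metric K)"
proof
  show "0 \<le> shrunk_metric K x y" for x y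
    using shrunk_metric_ge[OF zero_lipschitz, of x y K] by (auto simp: shrunk_metric_def)
  show "shrunk_metric K x y = shrunk_metric K y x" for x y
    by (simp add: shrunk_metric_def abs_minus_commute conj_commute)
next
  fix x y assume M: "x \<in> M" "y \<in> M"
  show "shrunk_metric K x y = 0 \<longleftrightarrow> x = y"
  proof
    assume "shrunk_metric K x y = 0"
    then have "shrunk K x y \<le> 0" using shrunk_le_shrunk_metric[OF M, of K] by simp
    moreover have "0 < C ^ (K * depth x y)" using C by simp
    ultimately have "d x y \<le> 0" by (simp add: shrunk_def divide_le_0_iff not_le)
    then show "x = y" using M nonneg[of x y] by (metis antisym zero)
  next
    assume "x = y"
    moreover have "shrunk_lipschitz K \<noteq> {}" using zero_lipschitz by blast
    ultimately show "shrunk_metric K x y = 0" by (simp add: shrunk_metric_def)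
  qed
next
  fix x y z assume M: "x \<in> M" "y \<in> M" "z \<in> M"
  show "shrunk_metric K x z \<le> shrunk_metric K x y + shrunk_metric K y z"
  proof (rule shrunk_metric_least)
    fix u assume u: "u \<in> shrunk_lipschitz K"
    show "\<bar>u x - u z\<bar> \<le> shrunk_metric K x y + shrunk_metric K y z"
      using shrunk_metric_ge[OF u M(1,2)] shrunk_metric_ge[OF u M(2,3)] by linarith
  qed (use M in auto)
qed

section \<open>Topology and quasisymmetry of the new metric\<close>

lemma shrunk_metric_pos:
  assumes "x \<in> M" "y \<in> M" "x \<noteq> y"
  shows "0 < shrunk_metric K x y"
proof -
  interpret S: Metric_space M "shrunk_metric K" by (rule Metric_space_shrunk)
  show ?thesis using S.zero[of x y] S.nonneg[of x y] assms by linarith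
qed

lemma shrunk_metric_le_metric:
  assumes "x \<in> M" "y \<in> M"
  shows "shrunk_metric K x y \<le> d x y"
  using shrunk_metric_le[OF assms, of K] shrunk_le[of K x y] by linarith

text \<open>The new metric is at most \<open>d\<close>. Conversely, points at
  \<open>d\<close>-distance at least \<open>\<epsilon>\<close> have bounded depth, because the radii
  of the layers tend to 0, so their new distance stays away from 0.\<close>

lemma homeomorphic_map_shrunk:
  "homeomorphic_map mtopology (Metric_space.mtopology M (shrunk_metric K)) id"
proof -
  interpret S: Metric_space M "shrunk_metric K" by (rule Metric_space_shrunk)
  have "continuous_map mtopology S.mtopology id"
    unfolding metric_continuous_map[OF Metric_space_shrunk]
  proof (intro conjI ballI allI impI)
    fix a and \<epsilon> :: real assume "a \<in> M" "0 < \<epsilon>"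
    then show "\<exists>\<delta>>0. \<forall>x. x \<in> M \<and> d a x < \<delta> \<longrightarrow> shrunk_metric K (id a) (id x) < \<epsilon>"
      using shrunk_metric_le_metric[of a] by (intro exI[of _ \<epsilon>]) (auto intro: le_less_trans)
  qed simp
  moreover have "continuous_map S.mtopology mtopology id"
    unfolding S.metric_continuous_map[OF Metric_space_axioms]
  proof (intro conjI ballI allI impI)
    fix a and \<epsilon> :: real assume a: "a \<in> M" and \<epsilon>: "0 < \<epsilon>"
    obtain n where n: "2 * top_radius / \<epsilon> < C ^ n"
      using real_arch_pow[of C "2 * top_radius / \<epsilon>"] C by auto
    define \<delta> where "\<delta> = \<epsilon> / C ^ (K * n) / (2 * C ^ K)"
    have "d a x < \<epsilon>" if x: "x \<in> M" "shrunk_metric K a x < \<delta>" for x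
    proof (rule ccontr)
      assume "\<not> d a x < \<epsilon>"
      then have ge: "\<epsilon> \<le> d a x" by simp
      then have ne: "a \<noteq> x" using \<epsilon> a x by auto
      have "2 * top_radius < C ^ n * \<epsilon>" using n \<epsilon> by (simp add: divide_less_eq)
      also have "\<dots> \<le> C ^ n * d a x" using ge C by simp
      finally have "depth a x \<le> n"
        using near_dist[of n a x] near_iff_depth[OF a x(1) ne, of n] a x by fastforce
      then have "C ^ (K * depth a x) \<le> C ^ (K * n)"
        using C by (intro power_increasing mult_le_mono2) auto
      then have "\<epsilon> / C ^ (K * n) \<le> shrunk K a x"
        unfolding shrunk_def using ge \<epsilon> C by (intro frac_le) auto
      also have "\<dots> \<le> 2 * C ^ K * shrunk_metric K a x"
        by (rule shrunk_le_shrunk_metric[OF a x(1)])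
      finally show False using x(2) C by (simp add: \<delta>_def field_simps)
    qed
    moreover have "0 < \<delta>" using \<epsilon> C by (simp add: \<delta>_def)
    ultimately show "\<exists>\<delta>>0. \<forall>x. x \<in> M \<and> shrunk_metric K a x < \<delta> \<longrightarrow> d (id a) (id x) < \<epsilon>"
      by auto
  qed simp
  ultimately have "homeomorphic_maps mtopology S.mtopology id id"
    by (simp add: homeomorphic_maps_def)
  then show ?thesis using homeomorphic_maps_map by blast
qed

text \<open>If \<open>x\<close> and \<open>b\<close> stay together for \<open>i + 1\<close> more layers than \<open>x\<close> and \<open>a\<close>, then dilating
  their last common ball \<open>i\<close> times does not yet reach \<open>a\<close>, whence \<open>C ^ i < 1 + 2 * t\<close>.\<close>
lemma shrunk_ratio:
  assumes M: "x \<in> M" "a \<in> M" "b \<in> M" and ne: "x \<noteq> a" "x \<noteq> b"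
    and t: "d x a = t * d x b" "0 \<le> t"
  shows "shrunk K x a \<le> t * (C * (1 + 2 * t)) ^ K * shrunk K x b"
proof -
  have pow: "C ^ depth x b \<le> C * (1 + 2 * t) * C ^ depth x a"
  proof (cases "depth x b \<le> depth x a")
    case True
    have "C ^ depth x b \<le> C ^ depth x a" using True C by (intro power_increasing) auto
    also have "1 * 1 \<le> C * (1 + 2 * t)" using C t by (intro mult_mono) auto
    then have "1 * C ^ depth x a \<le> C * (1 + 2 * t) * C ^ depth x a"
      using C by (intro mult_right_mono) auto
    finally show ?thesis by simp
  next
    case False
    then obtain i where i: "depth x b = Suc (depth x a + i)"
      by (metis less_imp_Suc_add not_le)
    have "near (depth x a + i) x b" "\<not> near (depth x a) x a"
      using near_iff_depth M ne i by auto
    then have "C ^ i < 1 + 2 * t"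
      using near_dilate[of "depth x a" i x b a t] M t by force
    then have "C * C ^ depth x a * C ^ i \<le> C * C ^ depth x a * (1 + 2 * t)"
      using C by (intro mult_left_mono) auto
    then show ?thesis by (simp add: i power_add mult_ac)
  qed
  have "C ^ (K * depth x b) \<le> (C * (1 + 2 * t)) ^ K * C ^ (K * depth x a)"
    using power_mono[OF pow, of K] C by (simp add: power_mult_distrib power_mult[symmetric] mult.commute)
  then have "t * d x b * C ^ (K * depth x b) \<le> t * d x b * ((C * (1 + 2 * t)) ^ K * C ^ (K * depth x a))"
    using t by (intro mult_left_mono) auto
  then show ?thesis
    using C t by (simp add: shrunk_def field_simps)
qed

text \<open>\<open>shrunk_ratio\<close> carried over to the new metric: the numerator may be
  replaced by \<open>shrunk\<close> for free, the denominator at the cost of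
  \<open>2 * C ^ K\<close>. The case \<open>x = a\<close> is separate because \<open>depth\<close>
  is meaningful only for distinct points.\<close>

lemma quasisymmetric_shrunk:
  assumes M: "x \<in> M" "a \<in> M" "b \<in> M" and ne: "x \<noteq> b"
  shows "shrunk_metric K x a / shrunk_metric K x b
    \<le> 2 * C ^ K * (3 * C) ^ K * max (d x a / d x b) ((d x a / d x b) ^ Suc K)"
proof (cases "x = a")
  case True
  interpret S: Metric_space M "shrunk_metric K" by (rule Metric_space_shrunk)
  show ?thesis using True M C by (simp add: le_max_iff_disj)
next
  case False
  define t where "t = d x a / d x b"
  have "0 < d x b" using M ne by (simp add: less_le)
  then have t: "d x a = t * d x b" "0 \<le> t" by (auto simp: t_def)
  have "t * (1 + 2 * t) ^ K \<le> 3 ^ K * max t (t ^ Suc K)"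
  proof (cases "t \<le> 1")
    case True
    then have "(1 + 2 * t) ^ K \<le> 3 ^ K" using t by (intro power_mono) auto
    then have "t * (1 + 2 * t) ^ K \<le> t * 3 ^ K" using t by (intro mult_left_mono) auto
    also have "\<dots> \<le> 3 ^ K * max t (t ^ Suc K)" by (simp add: mult.commute)
    finally show ?thesis .
  next
    case False
    then have "(1 + 2 * t) ^ K \<le> (3 * t) ^ K" by (intro power_mono) auto
    then have "t * (1 + 2 * t) ^ K \<le> t * (3 * t) ^ K" using t by (intro mult_left_mono) auto
    also have "\<dots> = 3 ^ K * t ^ Suc K" by (simp add: power_mult_distrib)
    also have "\<dots> \<le> 3 ^ K * max t (t ^ Suc K)" by simp
    finally show ?thesis .
  qed
  then have "C ^ K * (t * (1 + 2 * t) ^ K) \<le> C ^ K * (3 ^ K * max t (t ^ Suc K))"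
    using C by (intro mult_left_mono) auto
  then have fac: "t * (C * (1 + 2 * t)) ^ K \<le> (3 * C) ^ K * max t (t ^ Suc K)"
    by (simp add: power_mult_distrib mult_ac)
  have "shrunk_metric K x a \<le> shrunk K x a" by (rule shrunk_metric_le[OF M(1,2)])
  also have "\<dots> \<le> t * (C * (1 + 2 * t)) ^ K * shrunk K x b"
    by (rule shrunk_ratio[OF M False ne t])
  also have "\<dots> \<le> (3 * C) ^ K * max t (t ^ Suc K) * shrunk K x b"
    by (intro mult_right_mono fac shrunk_nonneg)
  also have "\<dots> \<le> (3 * C) ^ K * max t (t ^ Suc K) * (2 * C ^ K * shrunk_metric K x b)"
    using C t by (intro mult_left_mono shrunk_le_shrunk_metric M mult_nonneg_nonneg)
      (auto simp: le_max_iff_disj)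
  finally show ?thesis
    using shrunk_metric_pos[OF M(1,3) ne, of K] unfolding t_def[symmetric]
    by (simp add: pos_divide_le_eq mult_ac)
qed

lemma quasisymmetrically_equivalent_shrunk:
  "quasisymmetrically_equivalent M d M (shrunk_metric K)"
  unfolding quasisymmetrically_equivalent_def
proof (rule exI[of _ id], rule exI, rule exI, intro conjI)
  have A: "0 < 2 * C ^ K * (3 * C) ^ K" using C by simp
  show "homeomorphic_map mtopology (Metric_space.mtopology M (shrunk_metric K)) id"
    by (rule homeomorphic_map_shrunk)
  show "homeomorphism {0..} {0..} (\<lambda>t. 2 * C ^ K * (3 * C) ^ K * max t (t ^ Suc K))
      (\<lambda>v. min (v / (2 * C ^ K * (3 * C) ^ K)) (root (Suc K) (v / (2 * C ^ K * (3 * C) ^ K))))"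
    by (rule homeomorphism_max_power[OF A])
  show "strict_mono_on {0..} (\<lambda>t. 2 * C ^ K * (3 * C) ^ K * max t (t ^ Suc K))"
    by (rule homeomorphism_max_power[OF A])
  show "\<forall>x\<in>M. \<forall>a\<in>M. \<forall>b\<in>M. x \<noteq> b \<longrightarrow>
      shrunk_metric K (id x) (id a) / shrunk_metric K (id x) (id b)
      \<le> 2 * C ^ K * (3 * C) ^ K * max (d x a / d x b) ((d x a / d x b) ^ Suc K)"
    using quasisymmetric_shrunk by simp
qed

section \<open>Covering numbers in the new metric\<close>

lemma near_shrunk_metric:
  assumes "near j x y" "x \<in> M" "y \<in> M"
  shows "shrunk_metric K x y \<le> 2 * top_radius / (C ^ K) ^ Suc j"
proof (cases "x = y")
  case True
  interpret S: Metric_space M "shrunk_metric K" by (rule Metric_space_shrunk)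
  show ?thesis using True assms top_radius_pos C by simp
next
  case False
  \<comment> \<open>Layers are counted from 0, so sharing a ball of layer \<open>j\<close> means
    depth at least \<open>j + 1\<close>.\<close>
  have "Suc j \<le> depth x y" using near_iff_depth False assms by (simp add: Suc_le_eq)
  then have "C ^ (K * Suc j) \<le> C ^ (K * depth x y)"
    using C by (intro power_increasing mult_le_mono2) auto
  moreover have "1 * d x y \<le> C ^ j * d x y"
    using C_power_ge_1 by (intro mult_right_mono) auto
  then have "d x y \<le> 2 * top_radius" using near_dist[OF assms] by simp
  ultimately have "shrunk K x y \<le> 2 * top_radius / C ^ (K * Suc j)"
    unfolding shrunk_def using C top_radius_pos by (intro frac_le) auto
  then show ?thesis
    using shrunk_metric_le[of x y K] assms unfolding power_mult by linarith
qed

lemma covering_number_layer: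
  assumes "2 * top_radius / (C ^ K) ^ Suc j \<le> r"
  shows "covering_number M (shrunk_metric K) M r \<le> enat (card (L j))"
proof -
  define F where "F = (\<lambda>(p, \<rho>). {z \<in> M. d p z \<le> \<rho>}) ` L j"
  have "mdiam (shrunk_metric K) {z \<in> M. d p z \<le> \<rho>} \<le> ennreal r" if "(p, \<rho>) \<in> L j" for p \<rho>
    unfolding mdiam_def
  proof (intro SUP_least ennreal_leI)
    fix x y assume xy: "x \<in> {z \<in> M. d p z \<le> \<rho>}" "y \<in> {z \<in> M. d p z \<le> \<rho>}"
    then have "near j x y" using that by (auto simp: near_def)
    then show "shrunk_metric K x y \<le> r"
      using near_shrunk_metric[of j x y K] xy assms by simp
  qed
  then have "finite F \<and> (\<forall>E\<in>F. E \<subseteq> M \<and> mdiam (shrunk_metric K) E \<le> ennreal r) \<and> M \<subseteq> \<Union>F"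
    using finite_layer covers[of _ j] unfolding F_def by fastforce
  then have "covering_number M (shrunk_metric K) M r \<le> enat (card F)"
    unfolding covering_number_def by (intro Inf_lower) blast
  also have "\<dots> \<le> enat (card (L j))"
    unfolding F_def using card_image_le[OF finite_layer] by simp
  finally show ?thesis .
qed

text \<open>With \<open>K = G * N\<close> the diameters in layer \<open>j\<close> decay like
  \<open>B ^ (- j)\<close> for \<open>B = C ^ (G * N)\<close>, while the cardinality grows like
  \<open>C ^ (G * j)\<close>, the \<open>N\<close>-th root of \<open>B ^ j\<close>. The least
  sufficient layer has \<open>B ^ j \<le> R / r\<close>.\<close>

lemma covering_number_shrunk:
  assumes card: "\<And>j. real (card (L j)) \<le> C ^ (G * Suc j)" and G: "0 < G" and N: "0 < N"
  obtains A where "1 \<le> A" "\<And>r. 0 < r \<Longrightarrow> r \<le> 1 \<Longrightarrow>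
    \<exists>n. covering_number M (shrunk_metric (G * N)) M r \<le> enat n \<and>
      real n \<le> A * r powr (- (1 / real N))"
proof -
  \<comment> \<open>The bound \<open>1 \<le> R\<close> serves the layer \<open>j = 0\<close>, which
    has no predecessor that fails.\<close>
  define R where "R = max 1 (2 * top_radius)"
  define B where "B = C ^ (G * N)"
  define A where "A = C ^ G * R powr (1 / N)"
  have R: "1 \<le> R" "2 * top_radius \<le> R" by (auto simp: R_def)
  have "C \<le> B" unfolding B_def using C G N by (intro self_le_power) auto
  then have B: "1 < B" using C by simp
  have CG: "1 \<le> C ^ G" by (rule C_power_ge_1)
  have RN: "1 \<le> R powr (1 / N)" using R by (intro ge_one_powr_ge_zero) auto
  have A1: "1 \<le> A" unfolding A_def using mult_mono[OF CG RN] CG by simp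
  have "\<exists>n. covering_number M (shrunk_metric (G * N)) M r \<le> enat n \<and>
      real n \<le> A * r powr (- (1 / real N))" if r: "0 < r" "r \<le> 1" for r
  proof -
    obtain n where n: "R / r < B ^ n" using real_arch_pow[OF B] by blast
    define P where "P j \<longleftrightarrow> R / B ^ Suc j \<le> r" for j
    have "B ^ n \<le> B ^ Suc n" using B by (intro power_increasing) auto
    then have "R / r \<le> B ^ Suc n" using n by linarith
    then have "P n" unfolding P_def using r B by (simp add: field_simps)
    define j where "j = (LEAST j. P j)"
    have "P j" unfolding j_def by (rule LeastI[of P, OF \<open>P n\<close>])
    have "2 * top_radius / B ^ Suc j \<le> R / B ^ Suc j"
      using R B by (intro divide_right_mono) auto
    then have "2 * top_radius / B ^ Suc j \<le> r" using \<open>P j\<close> by (simp add: P_def)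
    then have "covering_number M (shrunk_metric (G * N)) M r \<le> enat (card (L j))"
      unfolding B_def by (rule covering_number_layer)
    moreover have "real (card (L j)) \<le> A * r powr (- (1 / N))"
    proof -
      have "B ^ j \<le> R / r"
      proof (cases j)
        case 0
        then show ?thesis using R r by (simp add: le_divide_eq)
      next
        case (Suc i)
        then have "\<not> P i" using not_less_Least[of i P] by (simp add: j_def)
        then show ?thesis unfolding P_def Suc using r B by (simp add: field_simps)
      qed
      then have "(B ^ j) powr (1 / N) \<le> (R / r) powr (1 / N)"
        using B by (intro powr_mono2) auto
      also have "\<dots> = R powr (1 / N) * r powr (- (1 / N))"
        using R r by (simp add: powr_divide powr_minus_divide)
      also have "(B ^ j) powr (1 / N) = C ^ (G * j)"
      proof -
        have "B ^ j = (C ^ (G * j)) ^ N" by (simp add: B_def mult_ac flip: power_mult)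
        then show ?thesis using C N by (simp add: powr_powr flip: powr_realpow)
      qed
      finally have "C ^ G * C ^ (G * j) \<le> C ^ G * (R powr (1 / N) * r powr (- (1 / N)))"
        using C by (intro mult_left_mono) auto
      then show ?thesis
        using card[of j] by (simp add: A_def power_add)
    qed
    ultimately show ?thesis by blast
  qed
  then show ?thesis using that A1 by blast
qed

end

subsection \<open>Existence of layers\<close>

context Metric_space
begin

text \<open>Layers come in windows \<open>b ^ k \<le> Suc j < b ^ Suc k\<close>. Window
  \<open>k\<close> lists the repeated coarsenings of one cover \<open>B k\<close>, coarsest first.
  The scale \<open>\<rho> k\<close> is small enough for the next window to fit inside this one, yet
  its logarithm is only linear in \<open>Suc j\<close>, which bounds the cardinality.\<close>

lemma layers_exist:
  assumes s: "0 < s" "s < 1" and C: "3 \<le> C" and m: "0 < m" and \<rho>\<^sub>0: "0 < \<rho>\<^sub>0"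
    and cov: "\<forall>\<rho>. 0 < \<rho> \<and> \<rho> \<le> \<rho>\<^sub>0 \<longrightarrow> (\<exists>B. ball_family B \<and>
      (\<forall>x\<in>M. \<exists>(p, r)\<in>B. d p x \<le> r) \<and> mass s B \<le> \<rho> \<and> (\<forall>(p, r)\<in>B. \<rho> ^ m \<le> r))"
  obtains L G where "\<And>j. ball_family (L j)" "\<And>j. absorbed C (L (Suc j)) (L j)"
    "\<And>j. packed s (L j)" "\<And>x j. x \<in> M \<Longrightarrow> \<exists>(p, r)\<in>L j. d p x \<le> r"
    "\<And>j. real (card (L j)) \<le> C ^ (G * Suc j)" "0 < G"
proof -
  define b where "b = 2 * m + 2"
  \<comment> \<open>\<open>w0\<close> brings all scales below \<open>\<rho>\<^sub>0\<close>; the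
    term \<open>2 * b\<close> in \<open>W\<close> makes \<open>(W - b) * b\<close> exceed
    \<open>m * W\<close>.\<close>
  obtain w0 where w0: "1 / \<rho>\<^sub>0 < C ^ w0" using real_arch_pow[of C "1 / \<rho>\<^sub>0"] C by auto
  define W where "W = 2 * b + w0"
  define \<rho> where "\<rho> k = 1 / C ^ (W * b ^ k)" for k
  have \<rho>: "0 < \<rho> k" "\<rho> k \<le> \<rho>\<^sub>0" "\<rho> k \<le> 1" for k
  proof -
    show "0 < \<rho> k" using C by (simp add: \<rho>_def)
    have "W * 1 \<le> W * b ^ k" by (intro mult_le_mono2 one_le_power) (simp add: b_def)
    moreover have "w0 \<le> W * 1" by (simp add: W_def)
    ultimately have "w0 \<le> W * b ^ k" by (rule order_trans[rotated])
    then have "C ^ w0 \<le> C ^ (W * b ^ k)" using C by (intro power_increasing) auto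
    then have "1 / \<rho>\<^sub>0 \<le> C ^ (W * b ^ k)" using w0 by linarith
    then show "\<rho> k \<le> \<rho>\<^sub>0" using \<rho>\<^sub>0 C by (simp add: \<rho>_def field_simps)
    show "\<rho> k \<le> 1" using C by (simp add: \<rho>_def)
  qed
  have "\<forall>k. \<exists>B. ball_family B \<and> (\<forall>x\<in>M. \<exists>(p, r)\<in>B. d p x \<le> r) \<and>
      mass s B \<le> \<rho> k \<and> (\<forall>(p, r)\<in>B. \<rho> k ^ m \<le> r)"
    using cov \<rho>(1,2) by blast
  from choice[OF this] obtain B where B0: "\<forall>k. ball_family (B k) \<and>
      (\<forall>x\<in>M. \<exists>(p, r)\<in>B k. d p x \<le> r) \<and> mass s (B k) \<le> \<rho> k \<and>
      (\<forall>(p, r)\<in>B k. \<rho> k ^ m \<le> r)" ..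
  have B: "ball_family (B k)" "\<And>x. x \<in> M \<Longrightarrow> \<exists>(p, r)\<in>B k. d p x \<le> r"
      "mass s (B k) \<le> \<rho> k" "\<And>p r. (p, r) \<in> B k \<Longrightarrow> \<rho> k ^ m \<le> r" for k
    using B0[rule_format, of k] by auto
  have "\<forall>A. \<exists>A'. ball_family A \<longrightarrow> ball_family A' \<and> absorbed C A A' \<and>
      mass s A' \<le> C powr s * mass s A \<and> card A' \<le> card A \<and> packed s A'"
    using coarsening_exists[of _ C s] C s by (metis less_le_trans zero_less_numeral)
  then obtain coarse where coarse: "ball_family A \<Longrightarrow> ball_family (coarse A) \<and>
      absorbed C A (coarse A) \<and> mass s (coarse A) \<le> C powr s * mass s A \<and>
      card (coarse A) \<le> card A \<and> packed s (coarse A)" for A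
    by metis
  \<comment> \<open>At least one coarsening is always applied, so that even \<open>T k 0\<close> is
    packed and has room around the balls of \<open>B k\<close>.\<close>
  define T where "T k i = (coarse ^^ Suc i) (B k)" for k i
  have T_Suc: "T k (Suc i) = coarse (T k i)" and T_0: "T k 0 = coarse (B k)" for k i
    by (simp_all add: T_def)
  have T_family: "ball_family (T k i)" for k i
    by (induction i) (use coarse B in \<open>auto simp: T_Suc T_0\<close>)
  have T_packed: "packed s (T k i)" for k i
    using coarse B T_family by (cases i) (auto simp: T_Suc T_0)
  have T_absorbed: "absorbed C (T k i) (T k (Suc i))" for k i
    using coarse T_family by (auto simp: T_Suc)
  have T_card: "card (T k i) \<le> card (B k)" for k i
  proof (induction i)
    case 0
    show ?case using coarse[OF B(1), of k] by (simp add: T_0)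
  next
    case (Suc i)
    then show ?case using coarse[OF T_family, of k i] by (simp add: T_Suc)
  qed
  have "C powr s \<le> C" using C s powr_mono[of s 1 C] by simp
  have mass_step: "mass s (coarse A) \<le> C * mass s A" if "ball_family A" for A
  proof -
    have "0 \<le> mass s A" unfolding mass_def by (intro sum_nonneg) auto
    then have "C powr s * mass s A \<le> C * mass s A"
      using \<open>C powr s \<le> C\<close> by (intro mult_right_mono)
    then show ?thesis using coarse[OF that] by linarith
  qed
  have T_mass: "mass s (T k i) \<le> C ^ Suc i * \<rho> k" for k i
  proof (induction i)
    case 0
    have "C * mass s (B k) \<le> C * \<rho> k" using B(3) C by (intro mult_left_mono) auto
    then show ?case using mass_step[OF B(1), of k] by (simp add: T_0)
  next
    case (Suc i)
    have "C * mass s (T k i) \<le> C * (C ^ Suc i * \<rho> k)" using Suc C by (intro mult_left_mono) auto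
    then show ?case using mass_step[OF T_family, of k i] by (simp add: T_Suc mult_ac)
  qed
  have absorbed_covers: "\<exists>(p, r)\<in>A'. d p x \<le> r"
    if fam: "ball_family A" "ball_family A'" and abs: "absorbed C A A'"
      and x: "x \<in> M" "\<exists>(p, r)\<in>A. d p x \<le> r" for A A' x
  proof -
    obtain p r where p: "(p, r) \<in> A" "d p x \<le> r" using x(2) by auto
    then obtain p' r' where p': "(p', r') \<in> A'" "d p p' + C * r \<le> r'"
      using abs by (fastforce simp: absorbed_def)
    have pM: "p \<in> M" "p' \<in> M" "0 < r" using fam p p' by (auto simp: ball_family_def)
    have "1 * r \<le> C * r" using C pM by (intro mult_right_mono) auto
    then have "d p' x \<le> r'"
      using triangle[of p' p x] pM x(1) p p' commute[of p p'] by linarith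
    then show ?thesis using p' by auto
  qed
  have T_covers: "\<exists>(p, r)\<in>T k i. d p x \<le> r" if "x \<in> M" for k i x
  proof (induction i)
    case 0
    show ?case unfolding T_0
      by (rule absorbed_covers[OF B(1)[of k] _ _ that B(2)[OF that]]) (use coarse B in auto)
  next
    case (Suc i)
    show ?case unfolding T_Suc
      by (rule absorbed_covers[OF T_family _ _ that Suc]) (use coarse T_family in auto)
  qed
  text \<open>Members of a later window are so small that they fit into the finest layer of the
    previous one.\<close>
  have window: "absorbed C (T (Suc k) i) (T k 0)" if i: "Suc i \<le> b ^ (k + 2)" for k i
    unfolding absorbed_def
  proof (clarify)
    fix p r assume pr: "(p, r) \<in> T (Suc k) i"
    then have p: "p \<in> M" "0 < r" using T_family[of "Suc k" i] by (auto simp: ball_family_def)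
    \<comment> \<open>The exponent of \<open>1 / C\<close> that remains after up to
      \<open>b ^ (k + 2)\<close> coarsenings, each costing a mass factor \<open>C\<close>.\<close>
    define e where "e = (W - b) * b ^ Suc k"
    have We: "W * b ^ Suc k = b ^ (k + 2) + e"
      unfolding e_def W_def by (simp add: algebra_simps)
    have "r powr s \<le> mass s (T (Suc k) i)"
      by (rule mass_pos_le[OF _ pr]) (use T_family in \<open>auto simp: ball_family_def\<close>)
    also have "\<dots> \<le> C ^ Suc i * \<rho> (Suc k)" by (rule T_mass)
    also have "\<dots> \<le> C ^ (b ^ (k + 2)) * \<rho> (Suc k)"
      using i \<rho>(1)[of "Suc k"] C by (intro mult_right_mono power_increasing) auto
    also have "\<dots> = 1 / C ^ e"
      unfolding \<rho>_def We power_add using C by simp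
    finally have rs: "r powr s \<le> 1 / C ^ e" .
    also have "\<dots> \<le> 1" using C by simp
    finally have "r powr s \<le> 1 powr s" by simp
    then have "r \<le> 1" using s p by (metis less_le_not_le linorder_not_less powr_less_mono2 zero_le_one)
    then have "r powr 1 \<le> r powr s" using p s by (intro powr_mono') auto
    then have "r \<le> 1 / C ^ e" using rs p by simp
    moreover have "Suc (m * (W * b ^ k)) \<le> e"
    proof -
      have "Suc (m * (W * b ^ k)) \<le> (m * W + 1) * b ^ k"
        using b_def by (simp add: algebra_simps)
      also have "\<dots> \<le> (W - b) * b * b ^ k"
      proof (intro mult_le_mono1)
        have "(W - b) * b = (b + w0) * (2 * m + 2)" by (simp add: W_def b_def)
        then show "m * W + 1 \<le> (W - b) * b" by (simp add: W_def b_def algebra_simps)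
      qed
      finally show ?thesis by (simp add: e_def mult_ac)
    qed
    then have "C ^ Suc (m * (W * b ^ k)) \<le> C ^ e" using C by (intro power_increasing) auto
    then have "1 / C ^ e \<le> 1 / C ^ Suc (m * (W * b ^ k))" using C by (intro divide_left_mono) auto
    ultimately have "C * r \<le> C * (1 / C ^ Suc (m * (W * b ^ k)))"
      using C by (intro mult_left_mono) auto
    also have "\<dots> = \<rho> k ^ m" using C by (simp add: \<rho>_def power_divide mult_ac flip: power_mult)
    finally have Cr: "C * r \<le> \<rho> k ^ m" .
    obtain q t where q: "(q, t) \<in> B k" "d q p \<le> t" using B(2)[OF p(1), of k] by auto
    have "absorbed C (B k) (T k 0)" using coarse B by (simp add: T_0)
    then obtain p' r' where p': "(p', r') \<in> T k 0" "d q p' + C * t \<le> r'"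
      using q(1) by (fastforce simp: absorbed_def)
    have qM: "q \<in> M" "p' \<in> M" using B(1)[of k] T_family[of k 0] q p' by (auto simp: ball_family_def)
    have t: "\<rho> k ^ m \<le> t" by (rule B(4)[OF q(1)])
    have "0 < \<rho> k ^ m" using \<rho>(1) by simp
    \<comment> \<open>One \<open>t\<close> pays for the distance from \<open>p\<close> to
      \<open>q\<close>, another for \<open>C * r \<le> \<rho> k ^ m \<le> t\<close>.\<close>
    then have "3 * t \<le> C * t" using C t by (intro mult_right_mono) auto
    then have "d p p' + C * r \<le> r'"
      using triangle[of p q p'] p qM q(2) p'(2) t Cr \<open>0 < \<rho> k ^ m\<close> commute[of p q] by linarith
    then show "\<exists>(p', r')\<in>T k 0. d p p' + C * r \<le> r'" using p' by auto
  qed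
  have "\<exists>k. b ^ k \<le> Suc j \<and> Suc j < b ^ (k + 1)" for j
    by (rule ex_power_ivl1) (simp_all add: b_def)
  then obtain \<kappa> where \<kappa>: "b ^ \<kappa> j \<le> Suc j" "Suc j < b ^ Suc (\<kappa> j)" for j
    by (metis Suc_eq_plus1)
  have b1: "1 < b" by (simp add: b_def)
  \<comment> \<open>The count runs backwards: each further layer has one coarsening fewer, and the
    last one of a window, with \<open>j + 2 = b ^ Suc (\<kappa> j)\<close>, is
    \<open>T (\<kappa> j) 0\<close>.\<close>
  define L where "L j = T (\<kappa> j) (b ^ Suc (\<kappa> j) - Suc (Suc j))" for j
  have "absorbed C (L (Suc j)) (L j)" for j
  proof (cases "\<kappa> (Suc j) = \<kappa> j")
    case True
    have "b ^ Suc (\<kappa> j) - Suc (Suc j) = Suc (b ^ Suc (\<kappa> j) - Suc (Suc (Suc j)))"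
      using \<kappa>(2)[of "Suc j"] unfolding True by linarith
    then show ?thesis using T_absorbed by (simp add: L_def True)
  next
    case False
    have "b ^ \<kappa> j < b ^ Suc (\<kappa> (Suc j))"
      using \<kappa>(1)[of j] \<kappa>(2)[of "Suc j"] by linarith
    then have "\<kappa> j < Suc (\<kappa> (Suc j))" using b1 power_strict_increasing_iff by blast
    then have lt: "Suc (\<kappa> j) \<le> \<kappa> (Suc j)" using False by simp
    then have "b ^ Suc (\<kappa> j) \<le> b ^ \<kappa> (Suc j)" using b1 by (intro power_increasing) auto
    then have eq: "b ^ Suc (\<kappa> j) = Suc (Suc j)" "b ^ \<kappa> (Suc j) = b ^ Suc (\<kappa> j)"
      using \<kappa>(2)[of j] \<kappa>(1)[of "Suc j"] by linarith+
    then have \<kappa>eq: "\<kappa> (Suc j) = Suc (\<kappa> j)" using b1 power_inject_exp by blast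
    have "L j = T (\<kappa> j) 0" by (simp only: L_def eq(1) diff_self_eq_0)
    moreover have "Suc (b ^ Suc (\<kappa> (Suc j)) - Suc (Suc (Suc j))) \<le> b ^ (\<kappa> j + 2)"
      using \<kappa>(2)[of "Suc j"] unfolding \<kappa>eq by simp
    ultimately show ?thesis using window[of _ "\<kappa> j"] by (simp add: L_def \<kappa>eq)
  qed
  moreover have "real (card (L j)) \<le> C ^ ((W * m) * Suc j)" for j
  proof -
    let ?k = "\<kappa> j"
    \<comment> \<open>Each ball has at least this weight and the mass is at most 1, so there are at
      most \<open>1 / \<rho> ?k ^ m\<close> balls.\<close>
    have "(\<Sum>b\<in>B ?k. \<rho> ?k ^ m) \<le> mass s (B ?k)"
      unfolding mass_def
    proof (rule sum_mono, clarify)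
      fix p r assume "(p, r) \<in> B ?k"
      then have r: "\<rho> ?k ^ m \<le> r" "0 < r" using B(4) B(1)[of ?k] by (auto simp: ball_family_def)
      have le1: "0 < \<rho> ?k ^ m" "\<rho> ?k ^ m \<le> 1" using \<rho>[of ?k] by (auto intro: power_le_one less_imp_le)
      have "(\<rho> ?k ^ m) powr 1 \<le> (\<rho> ?k ^ m) powr s" using le1 s by (intro powr_mono') auto
      also have "\<dots> \<le> r powr s" using r le1 s by (intro powr_mono2) auto
      finally show "\<rho> ?k ^ m \<le> r powr s" using le1 by simp
    qed
    then have "real (card (B ?k)) * \<rho> ?k ^ m \<le> 1"
      using B(3)[of ?k] \<rho>(3)[of ?k] by simp
    then have "real (card (B ?k)) \<le> C ^ (W * b ^ ?k * m)"
      using C by (simp add: \<rho>_def power_divide divide_le_eq flip: power_mult)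
    also have "\<dots> \<le> C ^ ((W * m) * Suc j)"
    proof (rule power_increasing)
      have "W * m * b ^ ?k \<le> W * m * Suc j" by (intro mult_le_mono2 \<kappa>)
      then show "W * b ^ ?k * m \<le> W * m * Suc j" by (simp only: mult_ac)
    qed (use C in auto)
    finally show ?thesis using T_card[of ?k] unfolding L_def by (meson of_nat_le_iff order_trans)
  qed
  moreover have "0 < W * m" using m by (simp add: W_def b_def)
  ultimately show ?thesis
    using that[of L "W * m"] T_family T_packed T_covers by (simp add: L_def)
qed

end

subsection \<open>Dimensions\<close>

text \<open>For \<open>\<delta> \<le> 1\<close> a smaller \<open>\<theta>\<close> lowers the least
  admissible diameter, so more covers are allowed.\<close>

lemma upper_intermediate_dim_mono:
  assumes "0 < \<theta>\<^sub>1" "\<theta>\<^sub>1 \<le> \<theta>\<^sub>2"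
  shows "upper_intermediate_dim Z d A \<theta>\<^sub>1 \<le> upper_intermediate_dim Z d A \<theta>\<^sub>2"
  unfolding upper_intermediate_dim_def
proof (rule Inf_superset_mono, clarify, intro exI conjI, rule refl, assumption, intro allI impI)
  fix s \<epsilon> :: real
  assume cov: "\<forall>\<epsilon>>0. \<exists>\<delta>\<^sub>0>0. \<forall>\<delta>. 0 < \<delta> \<and> \<delta> \<le> \<delta>\<^sub>0 \<longrightarrow>
      (\<exists>(I :: nat set) U. A \<subseteq> (\<Union>i\<in>I. U i) \<and>
        (\<forall>i\<in>I. U i \<subseteq> Z \<and> ennreal (\<delta> powr (1 / \<theta>\<^sub>2)) \<le> mdiam d (U i) \<and> mdiam d (U i) \<le> ennreal \<delta>) \<and>
        (\<Sum>\<^sub>\<infinity>i\<in>I. ennreal (enn2real (mdiam d (U i)) powr s)) < ennreal \<epsilon>)" and "0 < \<epsilon>"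
  then obtain \<delta>\<^sub>0 where \<delta>\<^sub>0: "0 < \<delta>\<^sub>0" "\<And>\<delta>. 0 < \<delta> \<Longrightarrow> \<delta> \<le> \<delta>\<^sub>0 \<Longrightarrow>
      \<exists>(I :: nat set) U. A \<subseteq> (\<Union>i\<in>I. U i) \<and>
        (\<forall>i\<in>I. U i \<subseteq> Z \<and> ennreal (\<delta> powr (1 / \<theta>\<^sub>2)) \<le> mdiam d (U i) \<and> mdiam d (U i) \<le> ennreal \<delta>) \<and>
        (\<Sum>\<^sub>\<infinity>i\<in>I. ennreal (enn2real (mdiam d (U i)) powr s)) < ennreal \<epsilon>"
    by metis
  show "\<exists>\<delta>\<^sub>0>0. \<forall>\<delta>. 0 < \<delta> \<and> \<delta> \<le> \<delta>\<^sub>0 \<longrightarrow>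
      (\<exists>(I :: nat set) U. A \<subseteq> (\<Union>i\<in>I. U i) \<and>
        (\<forall>i\<in>I. U i \<subseteq> Z \<and> ennreal (\<delta> powr (1 / \<theta>\<^sub>1)) \<le> mdiam d (U i) \<and> mdiam d (U i) \<le> ennreal \<delta>) \<and>
        (\<Sum>\<^sub>\<infinity>i\<in>I. ennreal (enn2real (mdiam d (U i)) powr s)) < ennreal \<epsilon>)"
  proof (intro exI[of _ "min 1 \<delta>\<^sub>0"] conjI allI impI)
    fix \<delta> :: real assume \<delta>: "0 < \<delta> \<and> \<delta> \<le> min 1 \<delta>\<^sub>0"
    then obtain I :: "nat set" and U where IU: "A \<subseteq> (\<Union>i\<in>I. U i)"
      "\<And>i. i \<in> I \<Longrightarrow> U i \<subseteq> Z \<and> ennreal (\<delta> powr (1 / \<theta>\<^sub>2)) \<le> mdiam d (U i) \<and> mdiam d (U i) \<le> ennreal \<delta>"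
      "(\<Sum>\<^sub>\<infinity>i\<in>I. ennreal (enn2real (mdiam d (U i)) powr s)) < ennreal \<epsilon>"
      using \<delta>\<^sub>0(2)[of \<delta>] by auto
    have "1 / \<theta>\<^sub>2 \<le> 1 / \<theta>\<^sub>1" using assms by (intro divide_left_mono) auto
    then have "\<delta> powr (1 / \<theta>\<^sub>1) \<le> \<delta> powr (1 / \<theta>\<^sub>2)" using \<delta> by (intro powr_mono') auto
    then have "ennreal (\<delta> powr (1 / \<theta>\<^sub>1)) \<le> ennreal (\<delta> powr (1 / \<theta>\<^sub>2))" by (rule ennreal_leI)
    then have "ennreal (\<delta> powr (1 / \<theta>\<^sub>1)) \<le> mdiam d (U i)" if "i \<in> I" for i
      using IU(2)[OF that] order_trans by blast
    then show "\<exists>(I :: nat set) U. A \<subseteq> (\<Union>i\<in>I. U i) \<and>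
        (\<forall>i\<in>I. U i \<subseteq> Z \<and> ennreal (\<delta> powr (1 / \<theta>\<^sub>1)) \<le> mdiam d (U i) \<and> mdiam d (U i) \<le> ennreal \<delta>) \<and>
        (\<Sum>\<^sub>\<infinity>i\<in>I. ennreal (enn2real (mdiam d (U i)) powr s)) < ennreal \<epsilon>"
      using IU by (intro exI[of _ I] exI[of _ U] conjI ballI) blast+
  qed (use \<delta>\<^sub>0 in auto)
qed

text \<open>Monotonicity in \<open>\<theta>\<close> shows that the limit exists and is the infimum,
  which gives \<open>Lim\<close> its intended value.\<close>

lemma quasi_Hausdorff_dim_lessD:
  assumes "quasi_Hausdorff_dim Z d A < a"
  obtains \<theta> where "0 < \<theta>" "upper_intermediate_dim Z d A \<theta> < a"
proof -
  let ?f = "upper_intermediate_dim Z d A"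
  have "(?f \<longlongrightarrow> (INF \<theta>\<in>{0<..}. ?f \<theta>)) (at_right 0)"
  proof (rule order_tendstoI)
    fix b assume b: "b < (INF \<theta>\<in>{0<..}. ?f \<theta>)"
    have "b < ?f \<theta>" if "0 < \<theta>" for \<theta>
      using less_le_trans[OF b INF_lower[of \<theta> "{0<..}" ?f]] that by simp
    then show "\<forall>\<^sub>F \<theta> in at_right 0. b < ?f \<theta>"
      using eventually_at_right_less[of 0] by (rule eventually_mono[rotated])
  next
    fix b assume "(INF \<theta>\<in>{0<..}. ?f \<theta>) < b"
    then obtain \<theta>\<^sub>0 where \<theta>\<^sub>0: "0 < \<theta>\<^sub>0" "?f \<theta>\<^sub>0 < b" by (auto simp: INF_less_iff)
    have "\<forall>\<^sub>F \<theta> in at_right 0. \<theta> \<in> {0<..<\<theta>\<^sub>0}" by (rule eventually_at_right_real[OF \<theta>\<^sub>0(1)])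
    then show "\<forall>\<^sub>F \<theta> in at_right 0. ?f \<theta> < b"
    proof (rule eventually_mono)
      fix \<theta> assume "\<theta> \<in> {0<..<\<theta>\<^sub>0}"
      then have "?f \<theta> \<le> ?f \<theta>\<^sub>0" by (intro upper_intermediate_dim_mono) auto
      then show "?f \<theta> < b" using \<theta>\<^sub>0(2) by (rule le_less_trans)
    qed
  qed
  then have "quasi_Hausdorff_dim Z d A = (INF \<theta>\<in>{0<..}. ?f \<theta>)"
    unfolding quasi_Hausdorff_dim_def by (intro tendsto_Lim) auto
  then show ?thesis using assms that by (auto simp: INF_less_iff)
qed

text \<open>Raising the exponent from \<open>s0\<close> to \<open>s0 + \<gamma>\<close> gains a
  factor \<open>\<delta> powr \<gamma>\<close> on sums below 1. With
  \<open>\<delta> = \<rho> powr (1 / \<gamma>)\<close> this factor is \<open>\<rho>\<close>, and the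
  lower bound for diameters becomes a fixed power of \<open>\<rho>\<close>.\<close>

lemma (in Metric_space) ball_covers_of_intermediate_dim:
  fixes Z :: "'b set"
  assumes \<iota>: "\<And>x y. x \<in> M \<Longrightarrow> y \<in> M \<Longrightarrow> d\<^sub>Z (\<iota> x) (\<iota> y) = d x y"
    and \<theta>: "0 < \<theta>" and dim: "upper_intermediate_dim Z d\<^sub>Z (\<iota> ` M) \<theta> < 1"
  obtains s m \<rho>\<^sub>0 where "0 < s" "s < 1" "0 < m" "0 < \<rho>\<^sub>0"
    "\<forall>\<rho>. 0 < \<rho> \<and> \<rho> \<le> \<rho>\<^sub>0 \<longrightarrow> (\<exists>B. ball_family B \<and>
      (\<forall>x\<in>M. \<exists>(p, r)\<in>B. d p x \<le> r) \<and> mass s B \<le> \<rho> \<and> (\<forall>(p, r)\<in>B. \<rho> ^ m \<le> r))"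
proof -
  obtain s0 where s0: "0 < s0" "s0 < 1" and cov0: "\<forall>\<epsilon>>0. \<exists>\<delta>\<^sub>0>0. \<forall>\<delta>. 0 < \<delta> \<and> \<delta> \<le> \<delta>\<^sub>0 \<longrightarrow>
      (\<exists>(I :: nat set) U. \<iota> ` M \<subseteq> (\<Union>i\<in>I. U i) \<and>
        (\<forall>i\<in>I. U i \<subseteq> Z \<and> ennreal (\<delta> powr (1 / \<theta>)) \<le> mdiam d\<^sub>Z (U i) \<and> mdiam d\<^sub>Z (U i) \<le> ennreal \<delta>) \<and>
        (\<Sum>\<^sub>\<infinity>i\<in>I. ennreal (enn2real (mdiam d\<^sub>Z (U i)) powr s0)) < ennreal \<epsilon>)"
    using dim unfolding upper_intermediate_dim_def Inf_less_iff by auto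
  obtain \<delta>\<^sub>0 where \<delta>\<^sub>0: "0 < \<delta>\<^sub>0" and cov: "\<And>\<delta>. 0 < \<delta> \<Longrightarrow> \<delta> \<le> \<delta>\<^sub>0 \<Longrightarrow>
      \<exists>(I :: nat set) U. \<iota> ` M \<subseteq> (\<Union>i\<in>I. U i) \<and>
        (\<forall>i\<in>I. U i \<subseteq> Z \<and> ennreal (\<delta> powr (1 / \<theta>)) \<le> mdiam d\<^sub>Z (U i) \<and> mdiam d\<^sub>Z (U i) \<le> ennreal \<delta>) \<and>
        (\<Sum>\<^sub>\<infinity>i\<in>I. ennreal (enn2real (mdiam d\<^sub>Z (U i)) powr s0)) < ennreal 1"
    using cov0[rule_format, of 1] by auto
  define \<gamma> where "\<gamma> = (1 - s0) / 2"
  define m where "m = nat \<lceil>1 / (\<gamma> * \<theta>)\<rceil>"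
  have \<gamma>: "0 < \<gamma>" "s0 + \<gamma> < 1" using s0 by (auto simp: \<gamma>_def field_simps)
  have m: "1 / (\<gamma> * \<theta>) \<le> real m" unfolding m_def by (rule real_nat_ceiling_ge)
  have "0 < 1 / (\<gamma> * \<theta>)" using \<gamma> \<theta> by simp
  then have m0: "0 < m" using m by (cases "m = 0") auto
  have "\<exists>B. ball_family B \<and> (\<forall>x\<in>M. \<exists>(p, r)\<in>B. d p x \<le> r) \<and> mass (s0 + \<gamma>) B \<le> \<rho> \<and>
      (\<forall>(p, r)\<in>B. \<rho> ^ m \<le> r)" if \<rho>: "0 < \<rho>" "\<rho> \<le> min 1 (\<delta>\<^sub>0 powr \<gamma>)" for \<rho>
  proof -
    define \<delta> where "\<delta> = \<rho> powr (1 / \<gamma>)"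
    have \<delta>: "0 < \<delta>" "\<delta> powr \<gamma> = \<rho>" using \<rho> \<gamma> by (auto simp: \<delta>_def powr_powr)
    have "\<delta> \<le> (\<delta>\<^sub>0 powr \<gamma>) powr (1 / \<gamma>)" unfolding \<delta>_def using \<rho> \<gamma> by (intro powr_mono2) auto
    then have "\<delta> \<le> \<delta>\<^sub>0" using \<gamma> \<delta>\<^sub>0 by (simp add: powr_powr)
    then obtain I :: "nat set" and U where U: "\<iota> ` M \<subseteq> (\<Union>i\<in>I. U i)"
      "\<And>i. i \<in> I \<Longrightarrow> ennreal (\<delta> powr (1 / \<theta>)) \<le> mdiam d\<^sub>Z (U i)"
      "\<And>i. i \<in> I \<Longrightarrow> mdiam d\<^sub>Z (U i) \<le> ennreal \<delta>"
      "(\<Sum>\<^sub>\<infinity>i\<in>I. ennreal (enn2real (mdiam d\<^sub>Z (U i)) powr s0)) < ennreal 1"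
      using cov[of \<delta>] \<delta>(1) by auto
    define r where "r i = enn2real (mdiam d\<^sub>Z (U i))" for i
    have mdiam: "mdiam d\<^sub>Z (U i) = ennreal (r i)" if "i \<in> I" for i
      using U(3)[OF that] by (auto simp: r_def le_less_trans ennreal_enn2real_if top_unique)
    have r: "\<delta> powr (1 / \<theta>) \<le> r i" "r i \<le> \<delta>" if "i \<in> I" for i
      using U(2,3)[OF that] \<delta>(1) unfolding mdiam[OF that] by (auto simp: ennreal_le_iff2)
    have "\<delta> powr (1 / \<theta>) = \<rho> powr (1 / (\<gamma> * \<theta>))" by (simp add: \<delta>_def powr_powr)
    moreover have "\<rho> powr real m \<le> \<rho> powr (1 / (\<gamma> * \<theta>))" using \<rho> m by (intro powr_mono') auto
    ultimately have rm: "\<rho> ^ m \<le> r i" if "i \<in> I" for i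
      using r(1)[OF that] \<rho> by (simp add: powr_realpow)
    have r_pos: "0 < r i" if "i \<in> I" for i
      using rm[OF that] \<rho>(1) by (meson less_le_trans zero_less_power)
    have sum_less: "(\<Sum>i\<in>F. r i powr s0) < 1" if "finite F" "F \<subseteq> I" for F
    proof -
      have "ennreal (\<Sum>i\<in>F. r i powr s0) = (\<Sum>i\<in>F. ennreal (r i powr s0))"
        by (simp add: sum_ennreal)
      also have "\<dots> \<le> (\<Sum>\<^sub>\<infinity>i\<in>I. ennreal (r i powr s0))"
        by (subst nonneg_infsum_complete) (use that in \<open>auto intro: SUP_upper\<close>)
      also have "\<dots> < ennreal 1" using U(4) by (simp add: r_def)
      finally show ?thesis by (simp add: ennreal_less_iff sum_nonneg)
    qed
    \<comment> \<open>All terms are bounded below by a positive constant, while their sum is below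
      1.\<close>
    have "finite I"
    proof (rule ccontr)
      assume "infinite I"
      define c where "c = (\<rho> ^ m) powr s0"
      have c: "0 < c" using \<rho> by (simp add: c_def)
      obtain n :: nat where n: "1 / c < real n" using reals_Archimedean2 by blast
      obtain F where F: "F \<subseteq> I" "finite F" "card F = n"
        using infinite_arbitrarily_large[OF \<open>infinite I\<close>] by blast
      have "real n * c \<le> (\<Sum>i\<in>F. r i powr s0)"
        unfolding F(3)[symmetric]
        by (rule sum_bounded_below) (use F rm \<rho> s0 in \<open>auto simp: c_def intro!: powr_mono2\<close>)
      then show False using sum_less[OF F(2,1)] n c by (simp add: field_simps)
    qed
    \<comment> \<open>Sets that miss the image offer no centre in \<open>M\<close>. In the others
      any point of the image serves, with the full diameter as radius.\<close>
    define J where "J = {i \<in> I. U i \<inter> \<iota> ` M \<noteq> {}}"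
    have J: "finite J" "J \<subseteq> I" using \<open>finite I\<close> by (auto simp: J_def)
    have "\<forall>i\<in>J. \<exists>x\<in>M. \<iota> x \<in> U i" by (auto simp: J_def)
    then obtain c where c: "\<And>i. i \<in> J \<Longrightarrow> c i \<in> M \<and> \<iota> (c i) \<in> U i" by metis
    define B where "B = (\<lambda>i. (c i, r i)) ` J"
    have "ball_family B" using J c r_pos by (auto simp: ball_family_def B_def)
    moreover have "\<exists>(p, t)\<in>B. d p x \<le> t" if x: "x \<in> M" for x
    proof -
      obtain i where i: "i \<in> I" "\<iota> x \<in> U i" using U(1) x by auto
      then have iJ: "i \<in> J" using x by (auto simp: J_def)
      have "ennreal (d\<^sub>Z (\<iota> (c i)) (\<iota> x)) \<le> mdiam d\<^sub>Z (U i)"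
        unfolding mdiam_def using c[OF iJ] i by (intro SUP_upper2[of "\<iota> (c i)"] SUP_upper2[of "\<iota> x"]) auto
      then have "d (c i) x \<le> r i"
        using \<iota>[of "c i" x] c[OF iJ] x mdiam[OF i(1)] r_pos[OF i(1)] by (simp add: ennreal_le_iff)
      then show ?thesis using iJ by (auto simp: B_def)
    qed
    moreover have "mass (s0 + \<gamma>) B \<le> \<rho>"
    proof -
      have "mass (s0 + \<gamma>) B \<le> (\<Sum>i\<in>J. r i powr (s0 + \<gamma>))"
        unfolding B_def by (rule mass_image_le[OF J(1)])
      also have "\<dots> \<le> (\<Sum>i\<in>J. r i powr s0 * \<rho>)"
      proof (rule sum_mono)
        fix i assume "i \<in> J"
        then have i: "i \<in> I" using J by auto
        have "r i powr \<gamma> \<le> \<delta> powr \<gamma>" using r(2)[OF i] r_pos[OF i] \<gamma> by (intro powr_mono2) auto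
        then show "r i powr (s0 + \<gamma>) \<le> r i powr s0 * \<rho>"
          unfolding powr_add \<delta>(2) by (intro mult_left_mono) auto
      qed
      also have "\<dots> = (\<Sum>i\<in>J. r i powr s0) * \<rho>" by (simp add: sum_distrib_right)
      also have "\<dots> \<le> 1 * \<rho>" using sum_less[OF J] \<rho> by (intro mult_right_mono) auto
      finally show ?thesis by simp
    qed
    moreover have "\<forall>(p, t)\<in>B. \<rho> ^ m \<le> t" using rm J by (auto simp: B_def)
    ultimately show ?thesis by blast
  qed
  then show ?thesis using that[of "s0 + \<gamma>" m "min 1 (\<delta>\<^sub>0 powr \<gamma>)"] s0 \<gamma> m0 \<delta>\<^sub>0 by auto
qed

lemma (in Metric_space) small_quasisymmetric_metric:
  assumes s: "0 < s" "s < 1" and m: "0 < m" and \<rho>\<^sub>0: "0 < \<rho>\<^sub>0"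
    and cov: "\<forall>\<rho>. 0 < \<rho> \<and> \<rho> \<le> \<rho>\<^sub>0 \<longrightarrow> (\<exists>B. ball_family B \<and>
      (\<forall>x\<in>M. \<exists>(p, r)\<in>B. d p x \<le> r) \<and> mass s B \<le> \<rho> \<and> (\<forall>(p, r)\<in>B. \<rho> ^ m \<le> r))"
    and \<epsilon>: "0 < \<epsilon>"
  obtains e A where "Metric_space M e" "quasisymmetrically_equivalent M d M e" "1 \<le> A"
    "\<And>r. 0 < r \<Longrightarrow> r \<le> 1 \<Longrightarrow>
      \<exists>n. covering_number M e M r \<le> enat n \<and> real n \<le> A * r powr (- \<epsilon>)"
proof -
  \<comment> \<open>Chosen to make \<open>12 * (2 / (C - 1)) powr (1 - s)\<close> equal to
    1.\<close>
  define C where "C = 1 + 2 * 12 powr (1 / (1 - s))"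
  have "1 \<le> (12 :: real) powr (1 / (1 - s))" using s by (intro ge_one_powr_ge_zero) auto
  then have C3: "3 \<le> C" by (simp add: C_def)
  have "2 / (C - 1) = 1 / 12 powr (1 / (1 - s))" by (simp add: C_def)
  then have "(2 / (C - 1)) powr (1 - s) = 1 / 12"
    using s by (simp add: powr_divide powr_powr)
  then have C12: "12 * (2 / (C - 1)) powr (1 - s) \<le> 1" by simp
  obtain L G where L: "\<And>j. ball_family (L j)" "\<And>j. absorbed C (L (Suc j)) (L j)"
    "\<And>j. packed s (L j)" "\<And>x j. x \<in> M \<Longrightarrow> \<exists>(p, r)\<in>L j. d p x \<le> r"
    and card: "\<And>j. real (card (L j)) \<le> C ^ (G * Suc j)" and G: "0 < G"
    using layers_exist[OF s C3 m \<rho>\<^sub>0 cov] by metis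
  interpret layered_space M d L s C
    by unfold_locales (use L s C3 C12 in auto)
  obtain N where "N \<noteq> 0" and N: "inverse (real N) < \<epsilon>" using real_arch_inverse \<epsilon> by blast
  then have "0 < N" by simp
  obtain A where A: "1 \<le> A" "\<And>r. 0 < r \<Longrightarrow> r \<le> 1 \<Longrightarrow>
      \<exists>n. covering_number M (shrunk_metric (G * N)) M r \<le> enat n \<and>
        real n \<le> A * r powr (- (1 / real N))"
    using covering_number_shrunk[OF card G \<open>0 < N\<close>] by blast
  have "\<exists>n. covering_number M (shrunk_metric (G * N)) M r \<le> enat n \<and> real n \<le> A * r powr (- \<epsilon>)"
    if r: "0 < r" "r \<le> 1" for r
  proof -
    have "r powr (- (1 / real N)) \<le> r powr (- \<epsilon>)"
      using r N by (intro powr_mono') (auto simp: inverse_eq_divide)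
    then have "A * r powr (- (1 / real N)) \<le> A * r powr (- \<epsilon>)"
      using A by (intro mult_left_mono) auto
    then show ?thesis using A(2)[OF r] by (meson order_trans)
  qed
  then show ?thesis
    using that Metric_space_shrunk quasisymmetrically_equivalent_shrunk A(1) by blast
qed

section \<open>From covering numbers to the Assouad spectrum and the box-counting dimension\<close>

lemma covering_number_mono:
  assumes "A \<subseteq> B"
  shows "covering_number M d A r \<le> covering_number M d B r"
  unfolding covering_number_def by (rule Inf_superset_mono) (use assms subset_trans in fast)

lemma assouad_spectrum_le:
  assumes \<theta>: "0 < \<theta>" "\<theta> < 1" and \<epsilon>: "0 < \<epsilon>" and A: "1 \<le> A" and M: "Metric_space M e"
    and cov: "\<And>r. 0 < r \<Longrightarrow> r \<le> 1 \<Longrightarrow>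
      \<exists>n. covering_number M e M r \<le> enat n \<and> real n \<le> A * r powr (- (\<epsilon> * (1 - \<theta>)))"
  shows "assouad_spectrum \<theta> M e \<le> ereal \<epsilon>"
  unfolding assouad_spectrum_def
proof (rule Inf_lower, rule CollectI, rule exI[of _ \<epsilon>], intro conjI, rule refl, rule \<epsilon>,
    rule exI[of _ A], intro conjI ballI allI impI)
  fix x r R
  assume x: "x \<in> M"
    and rR: "0 < r \<and> r \<le> R powr (1 / \<theta>) \<and> R powr (1 / \<theta>) \<le> R \<and> R \<le> (1::real)"
  interpret Metric_space M e by (rule M)
  have R: "0 < R" using rR by linarith
  obtain n where n: "covering_number M e M r \<le> enat n" "real n \<le> A * r powr (- (\<epsilon> * (1 - \<theta>)))"
    using cov[of r] rR by auto
  \<comment> \<open>The gap between \<open>r\<close> and \<open>R\<close> gives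
    \<open>R / r \<ge> r powr (- (1 - \<theta>))\<close>, which explains the factor
    \<open>1 - \<theta>\<close> in the exponent of the hypothesis.\<close>
  have "r powr \<theta> \<le> (R powr (1 / \<theta>)) powr \<theta>" using rR \<theta> by (intro powr_mono2) auto
  then have "r powr \<theta> / r \<le> R / r" using \<theta> R rR by (intro divide_right_mono) (auto simp: powr_powr)
  moreover have "r powr \<theta> / r = r powr (- (1 - \<theta>))" using rR by (simp add: powr_diff)
  ultimately have "(r powr (- (1 - \<theta>))) powr \<epsilon> \<le> (R / r) powr \<epsilon>"
    using \<epsilon> by (intro powr_mono2) auto
  moreover have "- (1 - \<theta>) * \<epsilon> = - (\<epsilon> * (1 - \<theta>))" by (simp add: algebra_simps)
  ultimately have "r powr (- (\<epsilon> * (1 - \<theta>))) \<le> (R / r) powr \<epsilon>"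
    by (simp only: powr_powr)
  then have "A * r powr (- (\<epsilon> * (1 - \<theta>))) \<le> A * (R / r) powr \<epsilon>"
    using A by (intro mult_left_mono) auto
  then have nA: "real n \<le> A * (R / r) powr \<epsilon>" using n(2) by linarith
  have "covering_number M e (mcball x R) r \<le> covering_number M e M r"
    by (rule covering_number_mono) (auto simp: mcball_def)
  then have "ereal_of_enat (covering_number M e (mcball x R) r) \<le> ereal_of_enat (enat n)"
    using n(1) by (simp add: ereal_of_enat_le_iff del: ereal_of_enat_simps)
  also have "\<dots> \<le> ereal (A * (R / r) powr \<epsilon>)" using nA by simp
  finally show "ereal_of_enat (covering_number M e (mcball x R) r) \<le> ereal (A * (R / r) powr \<epsilon>)" .
qed (use A in auto)

lemma upper_box_dim_le:
  assumes \<epsilon>: "0 < \<epsilon>" and A: "1 \<le> A"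
    and cov: "\<And>r. 0 < r \<Longrightarrow> r \<le> 1 \<Longrightarrow>
      \<exists>n. covering_number M e M r \<le> enat n \<and> real n \<le> A * r powr (- \<epsilon>)"
  shows "upper_box_dim M e \<le> ereal (2 * \<epsilon>)"
  unfolding upper_box_dim_def
proof (rule Limsup_bounded)
  \<comment> \<open>Below \<open>r0\<close> the constant satisfies
    \<open>ln A \<le> \<epsilon> * - ln r\<close>, so it costs at most a second
    \<open>\<epsilon>\<close>.\<close>
  define r0 where "r0 = min 1 (exp (- (ln A / \<epsilon>)))"
  have "0 < r0" by (simp add: r0_def)
  then have "\<forall>\<^sub>F r in at_right 0. r \<in> {0<..<r0}" by (rule eventually_at_right_real)
  then show "\<forall>\<^sub>F r in at_right 0. (case covering_number M e M r of
      enat n \<Rightarrow> ereal (ln (real n) / - ln r) | \<infinity> \<Rightarrow> \<infinity>) \<le> ereal (2 * \<epsilon>)"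
  proof (rule eventually_mono)
    fix r assume "r \<in> {0<..<r0}"
    then have r: "0 < r" "r < 1" "r < exp (- (ln A / \<epsilon>))" by (auto simp: r0_def)
    then have lnr: "ln r < 0" "ln r < - (ln A / \<epsilon>)"
      using ln_less_cancel_iff[of r "exp (- (ln A / \<epsilon>))"] by auto
    obtain n where n: "covering_number M e M r \<le> enat n" "real n \<le> A * r powr (- \<epsilon>)"
      using cov[of r] r by auto
    then obtain n' where n': "covering_number M e M r = enat n'" "n' \<le> n"
      by (cases "covering_number M e M r") auto
    have "ln (real n') \<le> 2 * \<epsilon> * - ln r"
    \<comment> \<open>The value 0 occurs for the empty space, where \<open>ln 0 = 0\<close>
      applies.\<close>
    proof (cases "n' = 0")
      case True
      then show ?thesis using \<epsilon> lnr by (simp add: mult_nonneg_nonpos)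
    next
      case False
      then have "ln (real n') \<le> ln (A * r powr (- \<epsilon>))" using n n' by (intro ln_mono) auto
      also have "\<dots> = ln A + \<epsilon> * - ln r" using A r by (simp add: ln_mult ln_powr)
      also have "ln A \<le> \<epsilon> * - ln r" using lnr \<epsilon> by (simp add: field_simps)
      finally show ?thesis by simp
    qed
    then have "ln (real n') / - ln r \<le> 2 * \<epsilon>" using lnr by (subst pos_divide_le_eq) auto
    then show "(case covering_number M e M r of
        enat n \<Rightarrow> ereal (ln (real n) / - ln r) | \<infinity> \<Rightarrow> \<infinity>) \<le> ereal (2 * \<epsilon>)"
      by (simp add: n')
  qed
qed

lemma assouad_spectrum_nonneg: "0 \<le> assouad_spectrum \<theta> M d"
  unfolding assouad_spectrum_def by (rule Inf_greatest) auto

lemma upper_box_dim_nonneg: "0 \<le> upper_box_dim M d"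
  unfolding upper_box_dim_def
proof (rule le_Limsup)
  have "\<forall>\<^sub>F r :: real in at_right 0. r \<in> {0<..<1}" by (rule eventually_at_right_real) simp
  then show "\<forall>\<^sub>F r in at_right 0. 0 \<le> (case covering_number M d M r of
      enat n \<Rightarrow> ereal (ln (real n) / - ln r) | \<infinity> \<Rightarrow> \<infinity>)"
  proof (rule eventually_mono)
    fix r :: real assume r: "r \<in> {0<..<1}"
    have "0 \<le> ln (real n) / - ln r" for n
      using r by (cases "n = 0") (auto simp: divide_nonneg_neg divide_nonneg_nonneg simp del: divide_minus_right)
    then show "0 \<le> (case covering_number M d M r of
        enat n \<Rightarrow> ereal (ln (real n) / - ln r) | \<infinity> \<Rightarrow> \<infinity>)"
      by (auto split: enat.split)
  qed
qed simp

lemma conformal_dim_eq_0: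
  assumes "\<And>Y e. 0 \<le> D Y e"
    and "\<And>\<epsilon>. 0 < \<epsilon> \<Longrightarrow>
      \<exists>e. Metric_space M e \<and> quasisymmetrically_equivalent M d M e \<and> D M e \<le> ereal \<epsilon>"
  shows "conformal_dim D M d = 0"
proof (rule antisym)
  have "conformal_dim D M d \<le> ereal \<epsilon>" if \<epsilon>: "0 < \<epsilon>" for \<epsilon>
  proof -
    obtain e where e: "Metric_space M e" "quasisymmetrically_equivalent M d M e" "D M e \<le> ereal \<epsilon>"
      using assms(2)[OF \<epsilon>] by auto
    have "conformal_dim D M d \<le> D M e"
      unfolding conformal_dim_def by (rule Inf_lower) (use e in blast)
    then show ?thesis using e(3) by (rule order_trans)
  qed
  then show "conformal_dim D M d \<le> 0"
    using ereal_le_epsilon2[of "conformal_dim D M d" 0] by simp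
  show "0 \<le> conformal_dim D M d"
    unfolding conformal_dim_def by (rule Inf_greatest) (use assms(1) in auto)
qed

theorem theorem1p2:
  fixes X :: "'a set" and d :: "'a \<Rightarrow> 'a \<Rightarrow> real"
    and Z :: "'b set" and d\<^sub>Z :: "'b \<Rightarrow> 'b \<Rightarrow> real" and \<iota> :: "'a \<Rightarrow> 'b"
  assumes "Metric_space X d"
    and "Metric_space.mtotally_bounded X d X"
    and "doubling X d"
    and "Metric_space Z d\<^sub>Z"
    and "uniformly_perfect Z d\<^sub>Z"
    and "\<exists>p\<in>Z. \<exists>q\<in>Z. p \<noteq> q"
    and "\<iota> ` X \<subseteq> Z"
    and "\<And>x y. x \<in> X \<Longrightarrow> y \<in> X \<Longrightarrow> d\<^sub>Z (\<iota> x) (\<iota> y) = d x y"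
    and "quasi_Hausdorff_dim Z d\<^sub>Z (\<iota> ` X) < 1"
  shows "(\<forall>\<theta>. 0 < \<theta> \<and> \<theta> < 1 \<longrightarrow> conformal_dim (assouad_spectrum \<theta>) X d = 0)
    \<and> conformal_dim upper_box_dim X d = 0"
proof -
  interpret Metric_space X d by fact
  obtain \<theta>\<^sub>0 where \<theta>\<^sub>0: "0 < \<theta>\<^sub>0" "upper_intermediate_dim Z d\<^sub>Z (\<iota> ` X) \<theta>\<^sub>0 < 1"
    using quasi_Hausdorff_dim_lessD[OF assms(9)] .
  obtain s m \<rho>\<^sub>0 where sm: "0 < s" "s < 1" "0 < m" "0 < \<rho>\<^sub>0"
    "\<forall>\<rho>. 0 < \<rho> \<and> \<rho> \<le> \<rho>\<^sub>0 \<longrightarrow> (\<exists>B. ball_family B \<and>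
      (\<forall>x\<in>X. \<exists>(p, r)\<in>B. d p x \<le> r) \<and> mass s B \<le> \<rho> \<and> (\<forall>(p, r)\<in>B. \<rho> ^ m \<le> r))"
    using ball_covers_of_intermediate_dim[OF assms(8) \<theta>\<^sub>0] by blast
  note small = small_quasisymmetric_metric[OF sm]
  have "conformal_dim (assouad_spectrum \<theta>) X d = 0" if \<theta>: "0 < \<theta>" "\<theta> < 1" for \<theta>
  proof (rule conformal_dim_eq_0[OF assouad_spectrum_nonneg])
    fix \<epsilon> :: real assume \<epsilon>: "0 < \<epsilon>"
    then have "0 < \<epsilon> * (1 - \<theta>)" using \<theta> by simp
    from small[OF this] obtain e A where "Metric_space X e" "quasisymmetrically_equivalent X d X e"
      "1 \<le> A" "\<And>r. 0 < r \<Longrightarrow> r \<le> 1 \<Longrightarrow>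
        \<exists>n. covering_number X e X r \<le> enat n \<and> real n \<le> A * r powr (- (\<epsilon> * (1 - \<theta>)))"
      by blast
    then show "\<exists>e. Metric_space X e \<and> quasisymmetrically_equivalent X d X e \<and>
        assouad_spectrum \<theta> X e \<le> ereal \<epsilon>"
      using assouad_spectrum_le[OF \<theta> \<epsilon>] by blast
  qed
  moreover have "conformal_dim upper_box_dim X d = 0"
  proof (rule conformal_dim_eq_0[OF upper_box_dim_nonneg])
    fix \<epsilon> :: real assume "0 < \<epsilon>"
    \<comment> \<open>Halved because \<open>upper_box_dim_le\<close> doubles the exponent.\<close>
    then have "0 < \<epsilon> / 2" by simp
    from small[OF this] obtain e A where "Metric_space X e" "quasisymmetrically_equivalent X d X e"
      "1 \<le> A" "\<And>r. 0 < r \<Longrightarrow> r \<le> 1 \<Longrightarrow>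
        \<exists>n. covering_number X e X r \<le> enat n \<and> real n \<le> A * r powr (- (\<epsilon> / 2))"
      by blast
    then show "\<exists>e. Metric_space X e \<and> quasisymmetrically_equivalent X d X e \<and>
        upper_box_dim X e \<le> ereal \<epsilon>"
      using upper_box_dim_le[OF \<open>0 < \<epsilon> / 2\<close>] by (metis field_sum_of_halves mult_2)
  qed
  ultimately show ?thesis by blast
qed

end
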